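(* A universal space of parameters $\tilde{\mathcal{F}}$ for $G_{5,2}$ can be obtained as the blowup of the surface $\mathcal{F}=\{((c_1:c_1'),(c_2:c_2'),(c_3:c_3'))\in(\mathbb{C}P^1)^3: c_1c_2'c_3=c_1'c_2c_3'\}$ at the point $((1:1),(1:1),(1:1))$. That is, let $\tilde{\mathcal{F}}$ be this blowup, and for every chart $M_{ij}$ and every admissible set $\sigma$ let $\tilde F_{\sigma,ij}\subset\tilde{\mathcal{F}}$ be the set of all $c$ for which there exists a sequence $(x_n,c_n)\in\mathring{\Delta}_{5,2}\times F_{ij}$ such that $c_n$ converges to $c$ in $\tilde{\mathcal{F}}$ and $h^{-1}(x_n,f_{ij}(c_n))$ converges to a point of $W_\sigma/T^5$. Then for every admissible set $\sigma$ and any two charts $M_{ij}$, $M_{kl}$, the space $\tilde F_{\sigma,ij}$ is homeomorphic to $\tilde F_{\sigma,kl}$.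
   Context: $G_{5,2}$ is the manifold of $2$-dimensional subspaces $L\subset\mathbb{C}^5$ with the action of $T^5\subset(\mathbb{C}^* )^5$ induced by the coordinatewise action. $P^{I}(L)$, $I\subset\{1,\dots,5\}$, $|I|=2$, are the Pl\"ucker coordinates, and $M_{ij}=\{L:P^{ij}(L)\ne0\}$ are the charts. For a set $\sigma$ of $2$-subsets, $W_\sigma=\{L:P^I(L)\neq0\iff I\in\sigma\}$; $\sigma$ is admissible if $W_\sigma\neq\emptyset$. The main stratum $W$ is the set where all $P^I\neq0$, and $F=W/(\mathbb{C}^* )^5$. The moment map is $\mu(L)=\sum_I|P^I(L)|^2\Lambda_I/\sum_I|P^I(L)|^2$ with $\Lambda_I\in\mathbb{R}^5$ the $0/1$ indicator vector of $I$; its image is the hypersimplex $\Delta_{5,2}=\{x\in[0,1]^5:\sum x_i=2\}$ and $\mu(W)=\mathring{\Delta}_{5,2}$ (relative interior). The map $h:W/T^5\to\mathring{\Delta}_{5,2}\times F$ given by the moment map and the projection $W/T^5\to F$ is a homeomorphism. Coordinates on $F$ in the chart $M_{ij}$, $i<j$: represent $L\in M_{ij}$ by the $5\times2$ matrix whose rows $i,j$ form the identity matrix and whose remaining three rows, in increasing order of index, are $(z_1,z_4),(z_2,z_5),(z_3,z_6)$; for $L\in W$ put $(c_1:c_1')=(z_1z_5:z_2z_4)$, $(c_2:c_2')=(z_1z_6:z_3z_4)$, $(c_3:c_3')=(z_2z_6:z_3z_5)$. This identifies $F$ with $F_{ij}=\{((c_1:c_1'),(c_2:c_2'),(c_3:c_3'))\in(\mathbb{C}P^1)^3: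 c_1c_2'c_3=c_1'c_2c_3',\ c_m,c_m'\neq0,\ c_m\ne c_m'\}$; $f_{ij}:F_{ij}\to F$ is the resulting homeomorphism. The surface $\mathcal{F}$ is smooth and contains $F_{ij}$, which does not contain the blown-up point, so $F_{ij}\subset\tilde{\mathcal{F}}$. *)

theory Defs
  imports "HOL-Analysis.Analysis"
begin

section \<open>Quotient and glued topologies\<close>

definition quotient_topology :: "'a topology \<Rightarrow> ('a \<Rightarrow> 'b) \<Rightarrow> 'b topology" where
  "quotient_topology X f =
     topology (\<lambda>U. U \<subseteq> f ` topspace X \<and> openin X {x \<in> topspace X. f x \<in> U})"

text \<open>The final topology on the union of the images of \<open>f\<close> and \<open>g\<close>, i.e. the quotient
  topology of the disjoint sum of \<open>X\<close> and \<open>Y\<close>.\<close>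

definition glue_topology ::
    "'a topology \<Rightarrow> ('a \<Rightarrow> 'c) \<Rightarrow> 'b topology \<Rightarrow> ('b \<Rightarrow> 'c) \<Rightarrow> 'c topology" where
  "glue_topology X f Y g =
     topology (\<lambda>U. U \<subseteq> f ` topspace X \<union> g ` topspace Y \<and>
                   openin X {x \<in> topspace X. f x \<in> U} \<and> openin Y {y \<in> topspace Y. g y \<in> U})"

lemma istopology_preimage:
  "istopology (\<lambda>U. U \<subseteq> S \<and> openin X {x \<in> topspace X. f x \<in> U})"
  unfolding istopology_def
proof (intro conjI allI impI)
  fix U V
  assume "U \<subseteq> S \<and> openin X {x \<in> topspace X. f x \<in> U}"
    and "V \<subseteq> S \<and> openin X {x \<in> topspace X. f x \<in> V}"
  moreover have "{x \<in> topspace X. f x \<in> U \<inter> V} =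
      {x \<in> topspace X. f x \<in> U} \<inter> {x \<in> topspace X. f x \<in> V}" by auto
  ultimately show "U \<inter> V \<subseteq> S" "openin X {x \<in> topspace X. f x \<in> U \<inter> V}" by auto
next
  fix \<K>
  assume K: "\<forall>U\<in>\<K>. U \<subseteq> S \<and> openin X {x \<in> topspace X. f x \<in> U}"
  have "{x \<in> topspace X. f x \<in> \<Union>\<K>} = (\<Union>U\<in>\<K>. {x \<in> topspace X. f x \<in> U})" by auto
  then show "openin X {x \<in> topspace X. f x \<in> \<Union>\<K>}" using K by auto
  show "\<Union>\<K> \<subseteq> S" using K by auto
qed

lemma openin_quotient_topology:
  "openin (quotient_topology X f) U \<longleftrightarrow>
     U \<subseteq> f ` topspace X \<and> openin X {x \<in> topspace X. f x \<in> U}"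
  unfolding quotient_topology_def by (simp add: topology_inverse' istopology_preimage)

lemma openin_glue_topology:
  "openin (glue_topology X f Y g) U \<longleftrightarrow>
     U \<subseteq> f ` topspace X \<union> g ` topspace Y \<and>
     openin X {x \<in> topspace X. f x \<in> U} \<and> openin Y {y \<in> topspace Y. g y \<in> U}"
proof -
  let ?S = "f ` topspace X \<union> g ` topspace Y"
  have "istopology (\<lambda>U. (U \<subseteq> ?S \<and> openin X {x \<in> topspace X. f x \<in> U}) \<and>
                        (U \<subseteq> ?S \<and> openin Y {y \<in> topspace Y. g y \<in> U}))"
    using istopology_preimage[of ?S X f] istopology_preimage[of ?S Y g]
    unfolding istopology_def by simp
  then have "istopology (\<lambda>U. U \<subseteq> ?S \<and> openin X {x \<in> topspace X. f x \<in> U} \<and>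
                            openin Y {y \<in> topspace Y. g y \<in> U})"
    by (rule back_subst[of istopology]) auto
  then show ?thesis
    unfolding glue_topology_def by (simp add: topology_inverse')
qed

lemma topspace_quotient_topology [simp]: "topspace (quotient_topology X f) = f ` topspace X"
proof -
  have "{x \<in> topspace X. f x \<in> f ` topspace X} = topspace X" by auto
  then have "openin (quotient_topology X f) (f ` topspace X)"
    by (simp add: openin_quotient_topology)
  then show ?thesis
    by (meson openin_quotient_topology openin_subset openin_topspace subset_antisym)
qed

lemma topspace_glue_topology [simp]:
  "topspace (glue_topology X f Y g) = f ` topspace X \<union> g ` topspace Y"
proof -
  have "{x \<in> topspace X. f x \<in> f ` topspace X \<union> g ` topspace Y} = topspace X"
    "{y \<in> topspace Y. g y \<in> f ` topspace X \<union> g ` topspace Y} = topspace Y" by auto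
  then have "openin (glue_topology X f Y g) (f ` topspace X \<union> g ` topspace Y)"
    by (simp add: openin_glue_topology)
  then show ?thesis
    by (meson openin_glue_topology openin_subset openin_topspace subset_antisym)
qed

lemma quotient_map_quotient_topology: "quotient_map X (quotient_topology X f) f"
  by (auto simp: quotient_map_def openin_quotient_topology)


section \<open>The Grassmannian and the torus action\<close>

text \<open>The coordinates of \<open>\<complex>\<^sup>5\<close> are indexed by the type \<^typ>\<open>5\<close>, whose elements are
  \<open>0 < 1 < 2 < 3 < 4\<close>; the element \<open>a\<close> stands for the index \<open>a + 1\<close> in \<open>{1,\<dots>,5}\<close>.
  Only the order of the indices is ever used.\<close>

definition two_planes :: "(complex^5) set set" where
  "two_planes = {L. vec.subspace L \<and> vec.dim L = 2}"

definition column_space :: "complex^2^5 \<Rightarrow> (complex^5) set" where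
  "column_space A = range (\<lambda>v. A *v v)"

definition full_rank :: "(complex^2^5) set" where
  "full_rank = {A. inj (\<lambda>v. A *v v)}"

definition G52 :: "(complex^5) set topology" where
  "G52 = quotient_topology (top_of_set full_rank) column_space"

definition torus :: "(complex^5) set" where
  "torus = {t. \<forall>i. norm (t $ i) = 1}"

definition ctorus :: "(complex^5) set" where
  "ctorus = {t. \<forall>i. t $ i \<noteq> 0}"

definition act :: "complex^5 \<Rightarrow> (complex^5) set \<Rightarrow> (complex^5) set" where
  "act t L = (\<lambda>v. \<chi> i. t $ i * v $ i) ` L"

definition orbit :: "(complex^5) set \<Rightarrow> (complex^5) set \<Rightarrow> (complex^5) set set" where
  "orbit T L = (\<lambda>t. act t L) ` T"

definition orbit_space :: "(complex^5) set set topology" where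
  "orbit_space = quotient_topology G52 (orbit torus)"


section \<open>Pluecker coordinates, strata, moment map\<close>

definition pairs :: "5 set set" where
  "pairs = {I. card I = 2}"

definition minor :: "complex^2^5 \<Rightarrow> 5 set \<Rightarrow> complex" where
  "minor A I = A $ Min I $ 1 * A $ Max I $ 2 - A $ Min I $ 2 * A $ Max I $ 1"

text \<open>Pluecker coordinates are homogeneous; a basis of \<open>L\<close> is chosen to get actual numbers.
  They are used only in ways that are invariant under a common rescaling.\<close>

definition frame :: "(complex^5) set \<Rightarrow> complex^2^5" where
  "frame L = (SOME A. A \<in> full_rank \<and> column_space A = L)"

definition plucker :: "5 set \<Rightarrow> (complex^5) set \<Rightarrow> complex" where
  "plucker I L = minor (frame L) I"

definition stratum :: "5 set set \<Rightarrow> (complex^5) set set" where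
  "stratum \<sigma> = {L \<in> two_planes. \<forall>I\<in>pairs. plucker I L \<noteq> 0 \<longleftrightarrow> I \<in> \<sigma>}"

definition admissible :: "5 set set \<Rightarrow> bool" where
  "admissible \<sigma> \<longleftrightarrow> \<sigma> \<subseteq> pairs \<and> stratum \<sigma> \<noteq> {}"

definition main_stratum :: "(complex^5) set set" where
  "main_stratum = {L \<in> two_planes. \<forall>I\<in>pairs. plucker I L \<noteq> 0}"

definition vertex :: "5 set \<Rightarrow> real^5" where
  "vertex I = (\<chi> i. if i \<in> I then 1 else 0)"

definition moment_map :: "(complex^5) set \<Rightarrow> real^5" where
  "moment_map L =
     (\<Sum>I\<in>pairs. (norm (plucker I L))\<^sup>2 *\<^sub>R vertex I) /\<^sub>R (\<Sum>I\<in>pairs. (norm (plucker I L))\<^sup>2)"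

definition hypersimplex :: "(real^5) set" where
  "hypersimplex = {x. (\<forall>i. 0 \<le> x $ i \<and> x $ i \<le> 1) \<and> (\<Sum>i\<in>UNIV. x $ i) = 2}"

definition F_main :: "(complex^5) set set set" where
  "F_main = orbit ctorus ` main_stratum"

text \<open>The map \<open>h\<close> on a \<open>T\<^sup>5\<close>-orbit \<open>q\<close> is computed on a representative of \<open>q\<close>; both components
  are constant on \<open>T\<^sup>5\<close>-orbits.\<close>

definition h_map :: "(complex^5) set set \<Rightarrow> (real^5) \<times> (complex^5) set set" where
  "h_map q = (let L = (SOME L. L \<in> q) in (moment_map L, orbit ctorus L))"

definition h_inv :: "(real^5) \<times> (complex^5) set set \<Rightarrow> (complex^5) set set" where
  "h_inv = inv_into (orbit torus ` main_stratum) h_map"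


section \<open>Projective spaces and the coordinates on the space of parameters\<close>

definition line :: "complex^'n \<Rightarrow> (complex^'n) set" where
  "line v = vec.span {v}"

definition proj_space :: "(complex^'n) set topology" where
  "proj_space = quotient_topology (top_of_set (UNIV - {0})) line"

type_synonym cp1 = "(complex^2) set"

definition hom2 :: "complex \<Rightarrow> complex \<Rightarrow> cp1" where
  "hom2 a b = line (vector [a, b])"

definition cp1_cubed :: "(cp1 \<times> cp1 \<times> cp1) topology" where
  "cp1_cubed = prod_topology proj_space (prod_topology proj_space proj_space)"

definition surface :: "(cp1 \<times> cp1 \<times> cp1) set" where
  "surface = {(hom2 c1 c1', hom2 c2 c2', hom2 c3 c3') | c1 c1' c2 c2' c3 c3'.
     (c1, c1') \<noteq> (0, 0) \<and> (c2, c2') \<noteq> (0, 0) \<and> (c3, c3') \<noteq> (0, 0) \<and>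
     c1 * c2' * c3 = c1' * c2 * c3'}"

text \<open>As a subset of \<open>(\<complex>P\<^sup>1)\<^sup>3\<close>, \<open>F\<^sub>i\<^sub>j\<close> is the same for all charts; only its identification
  \<open>f\<^sub>i\<^sub>j\<close> with \<open>F\<close> depends on \<open>i, j\<close>.\<close>

definition F_chart :: "5 \<Rightarrow> 5 \<Rightarrow> (cp1 \<times> cp1 \<times> cp1) set" where
  "F_chart i j = {(hom2 c1 c1', hom2 c2 c2', hom2 c3 c3') | c1 c1' c2 c2' c3 c3'.
     c1 * c2' * c3 = c1' * c2 * c3' \<and>
     c1 \<noteq> 0 \<and> c1' \<noteq> 0 \<and> c1 \<noteq> c1' \<and>
     c2 \<noteq> 0 \<and> c2' \<noteq> 0 \<and> c2 \<noteq> c2' \<and>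
     c3 \<noteq> 0 \<and> c3' \<noteq> 0 \<and> c3 \<noteq> c3'}"

text \<open>For \<open>i < j\<close> the matrix below exists and is unique exactly when \<open>plucker {i, j} L \<noteq> 0\<close>, that
  is, for \<open>L\<close> in the chart \<open>M\<^sub>i\<^sub>j\<close>, which contains the main stratum.\<close>

definition chart_matrix :: "5 \<Rightarrow> 5 \<Rightarrow> (complex^5) set \<Rightarrow> complex^2^5" where
  "chart_matrix i j L =
     (THE A. column_space A = L \<and> A $ i = vector [1, 0] \<and> A $ j = vector [0, 1])"

definition chart_coords :: "5 \<Rightarrow> 5 \<Rightarrow> (complex^5) set \<Rightarrow> cp1 \<times> cp1 \<times> cp1" where
  "chart_coords i j L =
     (let A = chart_matrix i j L;
          ks = sorted_list_of_set (UNIV - {i, j});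
          z1 = A $ (ks ! 0) $ 1; z4 = A $ (ks ! 0) $ 2;
          z2 = A $ (ks ! 1) $ 1; z5 = A $ (ks ! 1) $ 2;
          z3 = A $ (ks ! 2) $ 1; z6 = A $ (ks ! 2) $ 2
      in (hom2 (z1 * z5) (z2 * z4), hom2 (z1 * z6) (z3 * z4), hom2 (z2 * z6) (z3 * z5)))"

text \<open>The coordinates are constant on \<open>(\<complex>\<^sup>*)\<^sup>5\<close>-orbits in the main stratum; \<open>f\<^sub>i\<^sub>j\<close> is the inverse of
  the induced bijection from \<open>F\<close> to \<open>F\<^sub>i\<^sub>j\<close>.\<close>

definition F_coords :: "5 \<Rightarrow> 5 \<Rightarrow> (complex^5) set set \<Rightarrow> cp1 \<times> cp1 \<times> cp1" where
  "F_coords i j y = chart_coords i j (SOME L. L \<in> y)"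

definition f_chart :: "5 \<Rightarrow> 5 \<Rightarrow> cp1 \<times> cp1 \<times> cp1 \<Rightarrow> (complex^5) set set" where
  "f_chart i j = inv_into F_main (F_coords i j)"


section \<open>The blowup\<close>

text \<open>The blowup at \<open>a\<close> of an affine variety \<open>X \<subseteq> \<complex>\<^sup>n\<close>: the closure in \<open>X \<times> \<complex>P\<^bsup>n-1\<^esup>\<close> of the
  graph of \<open>x \<mapsto> [x - a]\<close>, \<open>x \<noteq> a\<close>.\<close>

definition affine_blowup ::
    "(complex^'n) set \<Rightarrow> complex^'n \<Rightarrow> ((complex^'n) \<times> (complex^'n) set) topology" where
  "affine_blowup X a =
     (let Y = prod_topology (top_of_set X) proj_space
      in subtopology Y (Y closure_of {(x, line (x - a)) | x. x \<in> X - {a}}))"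

definition affine_point :: "complex^3 \<Rightarrow> cp1 \<times> cp1 \<times> cp1" where
  "affine_point z = (hom2 (z $ 1) 1, hom2 (z $ 2) 1, hom2 (z $ 3) 1)"

definition center :: "cp1 \<times> cp1 \<times> cp1" where
  "center = (hom2 1 1, hom2 1 1, hom2 1 1)"

text \<open>The blowup of the surface at \<open>center\<close> is obtained by gluing the complement of \<open>center\<close> with
  the blowup of the affine part \<open>{c\<^sub>1', c\<^sub>2', c\<^sub>3' \<noteq> 0}\<close>, where \<open>center\<close> has coordinates
  \<open>(1,1,1)\<close>, along the points of the affine part other than \<open>center\<close>. A point \<open>Inl c\<close> of the blowup
  lies over \<open>c \<noteq> center\<close>; the points \<open>Inr l\<close> are those of the exceptional divisor,
  \<open>l\<close> being a tangent direction at \<open>center\<close>.\<close>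

type_synonym blowup_point = "(cp1 \<times> cp1 \<times> cp1) + (complex^3) set"

definition blowup_glue :: "(complex^3) \<times> (complex^3) set \<Rightarrow> blowup_point" where
  "blowup_glue = (\<lambda>(z, l). if affine_point z = center then Inr l else Inl (affine_point z))"

definition blowup :: "blowup_point topology" where
  "blowup =
     glue_topology (subtopology cp1_cubed (surface - {center})) Inl
                   (affine_blowup {z. affine_point z \<in> surface} (vector [1, 1, 1])) blowup_glue"


section \<open>The virtual spaces of parameters\<close>

definition F_tilde :: "5 set set \<Rightarrow> 5 \<Rightarrow> 5 \<Rightarrow> blowup_point set" where
  "F_tilde \<sigma> i j =
     {c \<in> topspace blowup. \<exists>x c_seq.
        (\<forall>n::nat. x n \<in> rel_interior hypersimplex \<and> c_seq n \<in> F_chart i j) \<and>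
        limitin blowup (\<lambda>n. Inl (c_seq n)) c sequentially \<and>
        (\<exists>q \<in> orbit torus ` stratum \<sigma>.
           limitin orbit_space (\<lambda>n. h_inv (x n, f_chart i j (c_seq n))) q sequentially)}"

end

theory Submission
  imports Defs
begin

text \<open>
  The rows of a matrix spanning a plane in the main stratum are five distinct points of \<open>\<complex>P\<^sup>1\<close>,
  and the three coordinates in the chart \<open>M\<^sub>i\<^sub>j\<close> are three of their cross-ratios. The two
  cross-ratios that omit the point \<open>i\<close> or \<open>j\<close> are indeterminate only at
  \<open>((1:1),(1:1),(1:1))\<close>, and blowing up this point resolves the indeterminacy. Hence five
  cross-ratios, one for each omitted point, embed the blowup into \<open>(\<complex>P\<^sup>1)\<^sup>5\<close>. Reordering four
  points changes their cross-ratio by a Moebius transformation, so for every chart all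
  cross-ratios extend continuously to the blowup. By compactness the change of charts
  \<open>f\<^sub>k\<^sub>l\<^sup>-\<^sup>1 \<circ> f\<^sub>i\<^sub>j\<close> extends to a homeomorphism between the closures of
  \<open>F\<^sub>i\<^sub>j\<close> and \<open>F\<^sub>k\<^sub>l\<close> in the blowup. It maps the sequences \<open>c\<^sub>n\<close> that define
  \<open>F_tilde \<sigma> i j\<close> to those that define \<open>F_tilde \<sigma> k l\<close>, because the points
  \<open>f\<^sub>i\<^sub>j(c\<^sub>n)\<close> of \<open>F\<close> remain the same.
\<close>

section \<open>Glued spaces and extension of maps to closures\<close>

text \<open>The space F parametrizes five distinct points of CP^1 up to projective transformations.
  The surface is a del Pezzo surface of degree six (toric, with a hexagon as polygon); blowing up
  the unit of its torus gives the del Pezzo surface of degree five, the Deligne-Mumford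
  compactification of F. All permutations of the five points act on it, but the three coordinates of
  a chart single out i and j and hide this symmetry. A transition map written in these coordinates
  is in general a rational map with points of indeterminacy, and a direct extension would require a
  separate formula near each of them. Cross-ratios avoid this, because a reordering of four points
  acts on all of CP^1. The blowup is given by gluing, so its compactness has to be shown by hand,
  while its Hausdorff property follows from the injection into (CP^1)^5. The closures of the chart
  images are a sufficient domain for the extended map, since they contain every limit of a sequence
  c_n.\<close>

lemma continuous_map_glue_topology:
  assumes "continuous_map X Z (h \<circ> f)" and "continuous_map Y Z (h \<circ> g)"
  shows "continuous_map (glue_topology X f Y g) Z h"
  unfolding continuous_map_def
proof (intro conjI allI impI)
  show "h \<in> topspace (glue_topology X f Y g) \<rightarrow> topspace Z"
    using assms by (auto simp: continuous_map_def Pi_iff)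
  fix U assume U: "openin Z U"
  let ?S = "f ` topspace X \<union> g ` topspace Y"
  have "{x \<in> topspace X. f x \<in> {x \<in> ?S. h x \<in> U}} = {x \<in> topspace X. (h \<circ> f) x \<in> U}"
    and "{y \<in> topspace Y. g y \<in> {x \<in> ?S. h x \<in> U}} = {y \<in> topspace Y. (h \<circ> g) y \<in> U}"
    by auto
  moreover have "openin X {x \<in> topspace X. (h \<circ> f) x \<in> U}"
    and "openin Y {y \<in> topspace Y. (h \<circ> g) y \<in> U}"
    using assms U by (auto simp: continuous_map_def)
  ultimately show "openin (glue_topology X f Y g) {x \<in> topspace (glue_topology X f Y g). h x \<in> U}"
    by (auto simp: openin_glue_topology)
qed

lemma continuous_map_glue_left: "continuous_map X (glue_topology X f Y g) f"
  by (auto simp: continuous_map_def openin_glue_topology)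

lemma continuous_map_glue_right: "continuous_map Y (glue_topology X f Y g) g"
  by (auto simp: continuous_map_def openin_glue_topology)

text \<open>A product of quotient maps need not be a quotient map, but openness passes to products.
  This is how the maps from vectors to tuples of lines are shown to be quotient maps.\<close>

lemma open_map_prod:
  assumes "open_map X X' f" and "open_map Y Y' g"
  shows "open_map (prod_topology X Y) (prod_topology X' Y') (\<lambda>(x, y). (f x, g y))"
  unfolding open_map_def
proof (intro allI impI)
  fix W assume W: "openin (prod_topology X Y) W"
  show "openin (prod_topology X' Y') ((\<lambda>(x, y). (f x, g y)) ` W)"
    unfolding openin_prod_topology_alt
  proof (intro allI impI)
    fix a b assume "(a, b) \<in> (\<lambda>(x, y). (f x, g y)) ` W"
    then obtain x y where xy: "(x, y) \<in> W" "a = f x" "b = g y" by auto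
    then obtain U V where UV: "openin X U" "openin Y V" "x \<in> U" "y \<in> V" "U \<times> V \<subseteq> W"
      using W[unfolded openin_prod_topology_alt, rule_format, OF xy(1)] by (elim exE conjE) (rule that)
    have "f ` U \<times> g ` V \<subseteq> (\<lambda>(x, y). (f x, g y)) ` W"
      using UV(5) by force
    moreover have "openin X' (f ` U)" and "openin Y' (g ` V)"
      using UV(1,2) assms unfolding open_map_def by auto
    moreover have "a \<in> f ` U" and "b \<in> g ` V" using UV xy by auto
    ultimately show "\<exists>U V. openin X' U \<and> openin Y' V \<and> a \<in> U \<and> b \<in> V \<and> U \<times> V \<subseteq> (\<lambda>(x, y). (f x, g y)) ` W"
      by (intro exI conjI)
  qed
qed

text \<open>An arbitrary quotient map need not remain one over a subspace \<open>S\<close>; an open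
  continuous map does, because it stays open between the full preimage of \<open>S\<close> and
  \<open>S\<close>.\<close>

lemma quotient_map_open_restriction:
  assumes "continuous_map X Y p" and "open_map X Y p" and "S \<subseteq> p ` topspace X"
  shows "quotient_map (subtopology X {x \<in> topspace X. p x \<in> S}) (subtopology Y S) p"
proof (rule continuous_open_imp_quotient_map)
  show "continuous_map (subtopology X {x \<in> topspace X. p x \<in> S}) (subtopology Y S) p"
    by (rule continuous_map_into_subtopology) (auto intro: continuous_map_from_subtopology assms)
  show "open_map (subtopology X {x \<in> topspace X. p x \<in> S}) (subtopology Y S) p"
    by (rule open_map_restriction[OF assms(2)]) auto
  show "p ` topspace (subtopology X {x \<in> topspace X. p x \<in> S}) = topspace (subtopology Y S)"
    using assms continuous_map_image_subset_topspace[OF assms(1)] by auto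
qed

text \<open>Compactness of \<open>B\<close> makes \<open>\<Psi>\<close> a closed embedding, so that \<open>\<Psi>\<inverse> \<circ> G\<close> is defined and continuous
  on the whole closure of the range of \<open>\<gamma>\<close>.\<close>

lemma compact_extension:
  assumes B: "compact_space B" and K: "Hausdorff_space K"
    and \<Psi>: "continuous_map B K \<Psi>" and inj: "inj_on \<Psi> (topspace B)"
    and G: "continuous_map B K G"
    and \<gamma>': "\<And>s. s \<in> S \<Longrightarrow> \<gamma>' s \<in> topspace B"
    and eq: "\<And>s. s \<in> S \<Longrightarrow> G (\<gamma> s) = \<Psi> (\<gamma>' s)"
  obtains \<Phi> where
    "continuous_map (subtopology B (B closure_of \<gamma> ` S)) (subtopology B (B closure_of \<gamma>' ` S)) \<Phi>"
    "\<And>s. s \<in> S \<Longrightarrow> \<Phi> (\<gamma> s) = \<gamma>' s"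
proof -
  let ?C = "B closure_of \<gamma> ` S" and ?C' = "B closure_of \<gamma>' ` S"
  define \<Phi> where "\<Phi> = inv_into (topspace B) \<Psi> \<circ> G"
  have cl: "closedin K (\<Psi> ` ?C')"
    using continuous_imp_closed_map[OF \<Psi> B K] by (simp add: closed_map_def)
  have GC: "G ` ?C \<subseteq> \<Psi> ` ?C'"
  proof -
    have "G ` ?C \<subseteq> K closure_of (G ` \<gamma> ` S)"
      by (rule continuous_map_image_closure_subset[OF G])
    also have "G ` \<gamma> ` S = \<Psi> ` \<gamma>' ` S"
      using eq by (force simp: image_image)
    also have "K closure_of \<dots> \<subseteq> \<Psi> ` ?C'"
      using closure_of_subset[of "\<gamma>' ` S" B] \<gamma>' by (intro closure_of_minimal cl image_mono) auto
    finally show ?thesis .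
  qed
  have inv: "continuous_map (subtopology K (\<Psi> ` ?C')) (subtopology B ?C') (inv_into (topspace B) \<Psi>)"
  proof (rule continuous_map_into_subtopology)
    show "continuous_map (subtopology K (\<Psi> ` ?C')) B (inv_into (topspace B) \<Psi>)"
      by (rule continuous_inverse_map[OF B K \<Psi>])
        (use inj closure_of_subset_topspace[of B "\<gamma>' ` S"] in \<open>auto simp: inv_into_f_f\<close>)
    show "inv_into (topspace B) \<Psi> \<in> topspace (subtopology K (\<Psi> ` ?C')) \<rightarrow> ?C'"
      using inj closure_of_subset_topspace[of B "\<gamma>' ` S"] by (auto simp: inv_into_f_f subset_iff)
  qed
  show thesis
  proof
    show "continuous_map (subtopology B ?C) (subtopology B ?C') \<Phi>"
      unfolding \<Phi>_def
    proof (rule continuous_map_compose[OF _ inv])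
      show "continuous_map (subtopology B ?C) (subtopology K (\<Psi> ` ?C')) G"
        using GC by (intro continuous_map_into_subtopology continuous_map_from_subtopology G) auto
    qed
    show "\<Phi> (\<gamma> s) = \<gamma>' s" if "s \<in> S" for s
      using that inj \<gamma>' eq by (simp add: \<Phi>_def inv_into_f_f)
  qed
qed

lemma continuous_map_id_on_closure:
  assumes "Hausdorff_space B" and T: "T \<subseteq> topspace B"
    and f: "continuous_map (subtopology B (B closure_of T)) B f"
    and id: "\<And>x. x \<in> T \<Longrightarrow> f x = x" and x: "x \<in> B closure_of T"
  shows "f x = x"
proof (rule forall_in_closure_of_eq[OF _ assms(1) f])
  have "T \<subseteq> B closure_of T" using T by (rule closure_of_subset)
  then show "x \<in> subtopology B (B closure_of T) closure_of T"
    using x closure_of_subtopology[of B "B closure_of T" T] by (simp add: Int_absorb1)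
qed (use id in \<open>auto intro: continuous_map_from_subtopology\<close>)

text \<open>The composite of the two extensions agrees with the identity on the range of \<gamma>
  (or \<gamma>'), which is dense in its closure, so it is the identity on the whole closure because
  \<open>B\<close> is Hausdorff. That \<open>B\<close> is Hausdorff comes from the injection \<Psi>
  into \<open>K\<close>.\<close>

lemma compact_extension_homeomorphic:
  assumes B: "compact_space B" and K: "Hausdorff_space K"
    and \<Psi>: "continuous_map B K \<Psi>" and inj: "inj_on \<Psi> (topspace B)"
    and G: "continuous_map B K G" and G': "continuous_map B K G'"
    and \<gamma>: "\<And>s. s \<in> S \<Longrightarrow> \<gamma> s \<in> topspace B" and \<gamma>': "\<And>s. s \<in> S \<Longrightarrow> \<gamma>' s \<in> topspace B"
    and eq: "\<And>s. s \<in> S \<Longrightarrow> G (\<gamma> s) = \<Psi> (\<gamma>' s)" and eq': "\<And>s. s \<in> S \<Longrightarrow> G' (\<gamma>' s) = \<Psi> (\<gamma> s)"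
  obtains \<Phi> \<Phi>' where
    "homeomorphic_maps (subtopology B (B closure_of \<gamma> ` S)) (subtopology B (B closure_of \<gamma>' ` S)) \<Phi> \<Phi>'"
    "\<And>s. s \<in> S \<Longrightarrow> \<Phi> (\<gamma> s) = \<gamma>' s" "\<And>s. s \<in> S \<Longrightarrow> \<Phi>' (\<gamma>' s) = \<gamma> s"
proof -
  let ?C = "B closure_of \<gamma> ` S" and ?C' = "B closure_of \<gamma>' ` S"
  obtain \<Phi> where \<Phi>: "continuous_map (subtopology B ?C) (subtopology B ?C') \<Phi>"
      "\<And>s. s \<in> S \<Longrightarrow> \<Phi> (\<gamma> s) = \<gamma>' s"
    by (rule compact_extension[where S = S and \<gamma> = \<gamma> and \<gamma>' = \<gamma>', OF B K \<Psi> inj G \<gamma>' eq]) (assumption | rule that)+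
  obtain \<Phi>' where \<Phi>': "continuous_map (subtopology B ?C') (subtopology B ?C) \<Phi>'"
      "\<And>s. s \<in> S \<Longrightarrow> \<Phi>' (\<gamma>' s) = \<gamma> s"
    by (rule compact_extension[where S = S and \<gamma> = \<gamma>' and \<gamma>' = \<gamma>, OF B K \<Psi> inj G' \<gamma> eq']) (assumption | rule that)+
  have H: "Hausdorff_space B"
    by (rule Hausdorff_space_injective_preimage[OF K \<Psi> inj])
  have "\<Phi>' (\<Phi> x) = x" if "x \<in> ?C" for x
  proof (rule continuous_map_id_on_closure[OF H, of "\<gamma> ` S" "\<lambda>x. \<Phi>' (\<Phi> x)"])
    show "continuous_map (subtopology B ?C) B (\<lambda>x. \<Phi>' (\<Phi> x))"
      using continuous_map_compose[OF \<Phi>(1) \<Phi>'(1)]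
      by (simp add: o_def continuous_map_in_subtopology)
  qed (use \<gamma> \<Phi>(2) \<Phi>'(2) that in auto)
  moreover have "\<Phi> (\<Phi>' x) = x" if "x \<in> ?C'" for x
  proof (rule continuous_map_id_on_closure[OF H, of "\<gamma>' ` S" "\<lambda>x. \<Phi> (\<Phi>' x)"])
    show "continuous_map (subtopology B ?C') B (\<lambda>x. \<Phi> (\<Phi>' x))"
      using continuous_map_compose[OF \<Phi>'(1) \<Phi>(1)]
      by (simp add: o_def continuous_map_in_subtopology)
  qed (use \<gamma>' \<Phi>(2) \<Phi>'(2) that in auto)
  ultimately show thesis
    using \<Phi> \<Phi>' by (intro that[of \<Phi> \<Phi>']) (auto simp: homeomorphic_maps_def)
qed

section \<open>Projective spaces\<close>

lemma line_eq: "line v = range (\<lambda>c. c *s v)"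
  unfolding line_def by (simp add: vec.span_singleton)

lemma line_scale: "c \<noteq> 0 \<Longrightarrow> line (c *s v) = line v"
proof -
  assume c: "c \<noteq> 0"
  have "d *s (c *s v) = (d * c) *s v" and "d *s v = (d / c) *s (c *s v)" for d
    using c by (simp_all add: vector_smult_assoc)
  then show ?thesis unfolding line_eq 
    by (intro subset_antisym image_subsetI) (metis rangeI)+
qed

lemma line_eqE:
  assumes "line v = line w" "v \<noteq> 0"
  obtains c where "c \<noteq> 0" "v = c *s w"
proof -
  have "1 *s v \<in> line w" unfolding assms(1)[symmetric] unfolding line_eq by (rule rangeI)
  then obtain c where "v = c *s w" unfolding line_eq by auto
  then show thesis using assms(2) that[of c] by (cases "c = 0") auto
qed

lemma continuous_map_line: "continuous_map (top_of_set (UNIV - {0})) proj_space line"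
  unfolding proj_space_def by (intro quotient_imp_continuous_map quotient_map_quotient_topology)

lemma topspace_proj_space: "topspace proj_space = line ` (UNIV - {0})"
  by (simp add: proj_space_def)

lemma line_in_proj_space [simp]: "v \<noteq> 0 \<Longrightarrow> line v \<in> topspace proj_space"
  by (auto simp: topspace_proj_space)

text \<open>The saturation of an open set is the union of its multiples by nonzero scalars, and each
  of these is open.\<close>

lemma open_map_line: "open_map (top_of_set (UNIV - {0})) proj_space line"
  unfolding open_map_def
proof (intro allI impI)
  fix U :: "(complex^'n) set" assume U: "openin (top_of_set (UNIV - {0})) U"
  then have oU: "open U" and U0: "0 \<notin> U" by (auto simp: openin_open_eq open_delete)
  have "{v \<in> UNIV - {0}. line v \<in> line ` U} = (\<Union>c\<in>UNIV-{0}. (\<lambda>v. c *s v) -` U)" (is "?L = ?R")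
  proof
    show "?L \<subseteq> ?R"
    proof
      fix v assume "v \<in> ?L"
      then obtain u where u: "u \<in> U" "line u = line v" by auto
      then obtain c where "c \<noteq> 0" "u = c *s v" using U0 line_eqE by metis
      then show "v \<in> ?R" using u by auto
    qed
    show "?R \<subseteq> ?L" using U0 line_scale by (auto simp: image_iff)
  qed
  moreover have "open ((\<lambda>v. c *s v) -` U)" for c :: complex
    by (intro open_vimage oU) (auto intro!: continuous_intros simp: vector_scalar_mult_def)
  ultimately have "open {v \<in> UNIV - {0}. line v \<in> line ` U}" by (auto intro: open_UN)
  then have "openin (top_of_set (UNIV - {0})) {v \<in> UNIV - {0}. line v \<in> line ` U}"
    by (rule open_subset[rotated]) auto
  then show "openin proj_space (line ` U)"
    using openin_subset[OF U]
    by (auto simp: proj_space_def openin_quotient_topology)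
qed

text \<open>The orthogonal projection onto a line embeds projective space into a space of matrices.\<close>

lemma Hausdorff_proj_space: "Hausdorff_space (proj_space :: (complex^'n) set topology)"
proof -
  define f :: "complex^'n \<Rightarrow> complex^'n^'n"
    where "f v = (\<chi> a b. v $ a * cnj (v $ b) / of_real ((norm v)\<^sup>2))" for v
  have f_line: "\<exists>c. v = c *s w" if "f v = f w" "v \<noteq> 0" for v w
  proof -
    \<comment> \<open>Column \<open>b\<close> of the matrix \<open>f v\<close> is a nonzero multiple
      of \<open>v\<close> as soon as \<open>v $ b\<close> is nonzero, so equal matrices force
      proportional vectors.\<close>
    obtain b where b: "v $ b \<noteq> 0" using \<open>v \<noteq> 0\<close> by (auto simp: vec_eq_iff)
    have "v $ a = (of_real ((norm v)\<^sup>2) / cnj (v $ b) * cnj (w $ b) / of_real ((norm w)\<^sup>2)) * w $ a" for a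
    proof -
      have "v $ a * cnj (v $ b) / of_real ((norm v)\<^sup>2) = w $ a * cnj (w $ b) / of_real ((norm w)\<^sup>2)"
        using that(1) unfolding f_def by (simp add: vec_eq_iff)
      moreover have "v $ a = v $ a * cnj (v $ b) / of_real ((norm v)\<^sup>2) * (of_real ((norm v)\<^sup>2) / cnj (v $ b))"
        using b \<open>v \<noteq> 0\<close> by simp
      ultimately show ?thesis by (metis (no_types, lifting) mult.assoc mult.commute times_divide_eq_right)
    qed
    then show ?thesis by (metis (no_types) vec_eq_iff vector_smult_component)
  qed
  have f_scale: "f (c *s v) = f v" if "c \<noteq> 0" for c v
  proof -
    have "norm (c *s v) = norm c * norm v"
      by (simp add: norm_vec_def norm_mult L2_set_right_distrib)
    then have "complex_of_real ((norm (c *s v))\<^sup>2) = c * cnj c * of_real ((norm v)\<^sup>2)"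
      by (simp only: complex_norm_square power_mult_distrib of_real_mult)
    moreover have "c * x * cnj (c * y) / (c * cnj c * z) = x * cnj y / z" for x y z
      using that by (cases "z = 0") (simp_all add: field_simps)
    ultimately show ?thesis
      by (simp add: f_def vec_eq_iff del: complex_cnj_mult of_real_power)
  qed
  have cf: "continuous_map (top_of_set (UNIV - {0})) euclidean f"
    unfolding f_def continuous_map_iff_continuous by (intro continuous_intros) auto
  have qm: "quotient_map (top_of_set (UNIV - {0 :: complex^'n})) proj_space line"
    by (simp add: proj_space_def quotient_map_quotient_topology)
  obtain g where g: "continuous_map proj_space euclidean g" 
      "\<And>v. v \<in> topspace (top_of_set (UNIV - {0})) \<Longrightarrow> g (line v) = f v"
    using quotient_map_lift_exists[OF qm cf] f_scale line_eqE
    by (metis DiffE insertI1 topspace_euclidean_subtopology)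
  have "inj_on g (topspace proj_space)"
  proof (rule inj_onI)
    fix x y assume "x \<in> topspace proj_space" "y \<in> topspace proj_space" "g x = g y"
    then obtain v w where vw: "x = line v" "y = line w" "v \<noteq> 0" "w \<noteq> 0"
      by (auto simp: topspace_proj_space)
    then have "f v = f w" using g(2)[of v] g(2)[of w] \<open>g x = g y\<close> by simp
    then obtain c where "v = c *s w" using f_line[OF \<open>f v = f w\<close> vw(3)] by (elim exE)
    then show "x = y" using vw line_scale[of c w] by (cases "c = 0") simp_all
  qed
  then show ?thesis
    using Hausdorff_space_injective_preimage[OF _ g(1)] by auto
qed

lemma vector_2_eq_0_iff: "vector [a, b] = (0 :: complex^2) \<longleftrightarrow> a = 0 \<and> b = 0"
  by (auto simp: vec_eq_iff forall_2 vector_2)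

lemma line_conv_hom2: "line u = hom2 (u $ 1) (u $ 2)"
proof -
  have "vector [u $ 1, u $ 2] = u"
    by (simp add: vec_eq_iff forall_2 vector_2)
  then show ?thesis by (simp add: hom2_def)
qed

lemma hom2_scale: "k \<noteq> 0 \<Longrightarrow> hom2 (k * a) (k * b) = hom2 a b"
proof -
  assume "k \<noteq> 0"
  have "vector [k * a, k * b] = k *s (vector [a, b] :: complex^2)"
    by (simp add: vec_eq_iff forall_2 vector_2)
  then show ?thesis using line_scale \<open>k \<noteq> 0\<close> by (simp add: hom2_def)
qed

lemma hom2_eqI:
  assumes "a * d = b * c" and "a \<noteq> 0 \<or> b \<noteq> 0" and "c \<noteq> 0 \<or> d \<noteq> 0"
  shows "hom2 a b = hom2 c d"
proof (cases "a = 0")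
  case True
  then have "c = 0" "b \<noteq> 0" "d \<noteq> 0" using assms by auto
  then show ?thesis using True hom2_scale[of "b / d" 0 d] by simp
next
  case False
  then have "c \<noteq> 0" using assms by auto
  then show ?thesis using False assms hom2_scale[of "a / c" c d] by (simp add: field_simps)
qed

lemma hom2_eq_iff:
  assumes "a \<noteq> 0 \<or> b \<noteq> 0" and "c \<noteq> 0 \<or> d \<noteq> 0"
  shows "hom2 a b = hom2 c d \<longleftrightarrow> a * d = b * c"
proof
  assume "hom2 a b = hom2 c d"
  moreover have "(vector [a, b] :: complex^2) \<noteq> 0" using assms by (simp add: vector_2_eq_0_iff)
  ultimately obtain k where "(vector [a, b] :: complex^2) = k *s vector [c, d]"
    unfolding hom2_def by (elim line_eqE) 
  then have "a = k * c" "b = k * d" by (simp_all add: vec_eq_iff forall_2 vector_2)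
  then show "a * d = b * c" by simp
qed (rule hom2_eqI[OF _ assms])

lemma vec2_eq_0_iff: "u = (0 :: complex^2) \<longleftrightarrow> u $ 1 = 0 \<and> u $ 2 = 0"
  by (auto simp: vec_eq_iff forall_2)

lemma vec3_eq_iff: "u = (v :: complex^3) \<longleftrightarrow> u $ 1 = v $ 1 \<and> u $ 2 = v $ 2 \<and> u $ 3 = v $ 3"
  by (auto simp: vec_eq_iff forall_3)

lemma continuous_on_vector_2:
  assumes "continuous_on S f" and "continuous_on S g"
  shows "continuous_on S (\<lambda>x. vector [f x, g x] :: complex^2)"
proof -
  have "continuous_on S (\<lambda>x. (\<chi> i. if i = 1 then f x else g x) :: complex^2)"
  proof (rule continuous_on_vec_lambda)
    show "continuous_on S (\<lambda>x. if i = (1 :: 2) then f x else g x)" for i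
      using assms by (cases "i = 1") simp_all
  qed
  moreover have "(\<chi> i. if i = 1 then f x else g x) = (vector [f x, g x] :: complex^2)" for x
    by (simp add: vec_eq_iff forall_2 vector_2)
  ultimately show ?thesis by simp
qed

lemma continuous_map_hom2:
  assumes "continuous_on S f" and "continuous_on S g" and "\<And>x. x \<in> S \<Longrightarrow> f x \<noteq> 0 \<or> g x \<noteq> 0"
  shows "continuous_map (top_of_set S) proj_space (\<lambda>x. hom2 (f x) (g x))"
proof -
  have "continuous_map (top_of_set S) (top_of_set (UNIV - {0})) (\<lambda>x. vector [f x, g x] :: complex^2)"
    using assms by (auto simp: continuous_on_vector_2 vector_2_eq_0_iff)
  from continuous_map_compose[OF this continuous_map_line]
  show ?thesis by (simp add: o_def hom2_def)
qed

section \<open>The five cross-ratios as functions on the blowup\<close>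

text \<open>In affine coordinates \<open>c\<close> on the surface, where \<open>c\<^sub>2 = c\<^sub>1 c\<^sub>3\<close>, \<open>ratio\<close> is
  \<open>(c\<^sub>2 - 1) / (c\<^sub>3 - 1) = (c\<^sub>1 c\<^sub>3 - 1) / (c\<^sub>3 - 1)\<close>. Homogenizing the two fractions gives two
  pairs of forms without a common zero off the blown-up point.\<close>

definition ratio :: "complex^2 \<Rightarrow> complex^2 \<Rightarrow> complex^2 \<Rightarrow> cp1" where
  "ratio u v w =
     (if (v $ 1 - v $ 2) * w $ 2 = 0 \<and> (w $ 1 - w $ 2) * v $ 2 = 0
      then hom2 (u $ 1 * w $ 1 - u $ 2 * w $ 2) (u $ 2 * (w $ 1 - w $ 2))
      else hom2 ((v $ 1 - v $ 2) * w $ 2) ((w $ 1 - w $ 2) * v $ 2))"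

text \<open>Inversion on CP^1. Exchanging the roles of i and j inverts all three chart coordinates,
  so \<open>flip\<close> turns the cross-ratio that omits j into the one that omits i.\<close>

definition flip :: "complex^2 \<Rightarrow> complex^2" where
  "flip u = vector [u $ 2, u $ 1]"

lemma flip_nth [simp]: "flip u $ 1 = u $ 2" "flip u $ 2 = u $ 1"
  by (simp_all add: flip_def vector_2)

lemma flip_scale: "flip (c *s u) = c *s flip u"
  by (simp add: vec_eq_iff forall_2)

lemma flip_eq_0_iff [simp]: "flip u = 0 \<longleftrightarrow> u = 0"
  by (auto simp: vec2_eq_0_iff)

text \<open>Homogeneous coordinates over \<open>surface - {center}\<close>. Working with vectors
  makes continuity a matter of polynomial forms; the results descend along the quotient map
  \<open>lines\<close>.\<close>

definition surface_cover :: "((complex^2) \<times> (complex^2) \<times> (complex^2)) set" where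
  "surface_cover = {(u, v, w). u \<noteq> 0 \<and> v \<noteq> 0 \<and> w \<noteq> 0 \<and> u $ 1 * v $ 2 * w $ 1 = u $ 2 * v $ 1 * w $ 2 \<and>
      \<not> (u $ 1 = u $ 2 \<and> v $ 1 = v $ 2 \<and> w $ 1 = w $ 2)}"

definition lines :: "(complex^2) \<times> (complex^2) \<times> (complex^2) \<Rightarrow> cp1 \<times> cp1 \<times> cp1" where
  "lines = (\<lambda>(u, v, w). (line u, line v, line w))"

lemma ratio_scale:
  assumes "a \<noteq> 0" "b \<noteq> 0" "c \<noteq> 0"
  shows "ratio (a *s u) (b *s v) (c *s w) = ratio u v w"
proof -
  have 1: "(b *s v) $ 1 - (b *s v) $ 2 = b * (v $ 1 - v $ 2)"
    "(c *s w) $ 1 - (c *s w) $ 2 = c * (w $ 1 - w $ 2)" by (simp_all add: algebra_simps)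
  have "hom2 ((a *s u) $ 1 * (c *s w) $ 1 - (a *s u) $ 2 * (c *s w) $ 2) ((a *s u) $ 2 * (c * (w $ 1 - w $ 2)))
    = hom2 (u $ 1 * w $ 1 - u $ 2 * w $ 2) (u $ 2 * (w $ 1 - w $ 2))"
    using hom2_scale[of "a * c" "u $ 1 * w $ 1 - u $ 2 * w $ 2" "u $ 2 * (w $ 1 - w $ 2)"] assms
    by (simp add: algebra_simps)
  moreover have "hom2 (b * (v $ 1 - v $ 2) * (c *s w) $ 2) (c * (w $ 1 - w $ 2) * (b *s v) $ 2)
    = hom2 ((v $ 1 - v $ 2) * w $ 2) ((w $ 1 - w $ 2) * v $ 2)"
    using hom2_scale[of "b * c" "(v $ 1 - v $ 2) * w $ 2" "(w $ 1 - w $ 2) * v $ 2"] assms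
    by (simp add: mult_ac)
  ultimately show ?thesis using assms unfolding ratio_def 1 by simp
qed

text \<open>By the equation of the surface the two pairs of forms are proportional, so they define
  the same point wherever both are nonzero.\<close>

lemma ratio_alternative:
  assumes uvw: "(u, v, w) \<in> surface_cover"
    and "u $ 1 * w $ 1 - u $ 2 * w $ 2 \<noteq> 0 \<or> u $ 2 * (w $ 1 - w $ 2) \<noteq> 0"
  shows "ratio u v w = hom2 (u $ 1 * w $ 1 - u $ 2 * w $ 2) (u $ 2 * (w $ 1 - w $ 2))"
proof (cases "(v $ 1 - v $ 2) * w $ 2 = 0 \<and> (w $ 1 - w $ 2) * v $ 2 = 0")
  case False
  have "u $ 1 * v $ 2 * w $ 1 = u $ 2 * v $ 1 * w $ 2" using uvw by (simp add: surface_cover_def)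
  then have "(v $ 1 - v $ 2) * w $ 2 * (u $ 2 * (w $ 1 - w $ 2))
      = (w $ 1 - w $ 2) * v $ 2 * (u $ 1 * w $ 1 - u $ 2 * w $ 2)" by algebra
  then have "hom2 ((v $ 1 - v $ 2) * w $ 2) ((w $ 1 - w $ 2) * v $ 2)
      = hom2 (u $ 1 * w $ 1 - u $ 2 * w $ 2) (u $ 2 * (w $ 1 - w $ 2))"
    using assms(2) False by (intro hom2_eqI) simp_all
  then show ?thesis using False by (simp only: ratio_def if_False)
qed (simp add: ratio_def)

text \<open>The equations v1 = v2 and w1 = w2 would force u1 = u2, which is the excluded point.
  Hence the first pair vanishes only where v2 = w2 = 0, and there the second pair equals w1 (u1,
  u2), which is nonzero.\<close>

lemma ratio_defined:
  assumes "(u, v, w) \<in> surface_cover" "(v $ 1 - v $ 2) * w $ 2 = 0" "(w $ 1 - w $ 2) * v $ 2 = 0"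
  shows "u $ 1 * w $ 1 - u $ 2 * w $ 2 \<noteq> 0 \<or> u $ 2 * (w $ 1 - w $ 2) \<noteq> 0"
  using assms by (auto simp: surface_cover_def vec2_eq_0_iff)

text \<open>Each pair of forms is continuous on the open set where it does not vanish. These two
  sets cover \<open>surface_cover\<close> and the values agree on the overlap.\<close>

lemma continuous_map_ratio: "continuous_map (top_of_set surface_cover) proj_space (\<lambda>(u, v, w). ratio u v w)"
proof -
  define T where "T b = (if b then {(u, v, w) \<in> surface_cover. (v $ 1 - v $ 2) * w $ 2 \<noteq> 0 \<or> (w $ 1 - w $ 2) * v $ 2 \<noteq> 0}
    else {(u, v, w) \<in> surface_cover. u $ 1 * w $ 1 - u $ 2 * w $ 2 \<noteq> 0 \<or> u $ 2 * (w $ 1 - w $ 2) \<noteq> 0})" for b :: bool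
  define f where "f b = (\<lambda>(u :: complex^2, v :: complex^2, w :: complex^2).
    if b then hom2 ((v $ 1 - v $ 2) * w $ 2) ((w $ 1 - w $ 2) * v $ 2)
    else hom2 (u $ 1 * w $ 1 - u $ 2 * w $ 2) (u $ 2 * (w $ 1 - w $ 2)))" for b
  have T_sub: "T b \<subseteq> surface_cover" for b by (auto simp: T_def)
  show ?thesis
  proof (rule pasting_lemma[where I = UNIV and T = T and f = f])
    fix b
    have "T b = surface_cover \<inter> (if b then {(u, v, w). (v $ 1 - v $ 2) * w $ 2 \<noteq> 0 \<or> (w $ 1 - w $ 2) * v $ 2 \<noteq> 0}
       else {(u, v, w). u $ 1 * w $ 1 - u $ 2 * w $ 2 \<noteq> 0 \<or> u $ 2 * (w $ 1 - w $ 2) \<noteq> 0})"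
      by (auto simp: T_def)
    moreover have "open {(u :: complex^2, v :: complex^2, w :: complex^2).
        (v $ 1 - v $ 2) * w $ 2 \<noteq> 0 \<or> (w $ 1 - w $ 2) * v $ 2 \<noteq> 0}"
      unfolding case_prod_beta by (intro open_Collect_disj open_Collect_neq continuous_intros)
    moreover have "open {(u :: complex^2, v :: complex^2, w :: complex^2).
        u $ 1 * w $ 1 - u $ 2 * w $ 2 \<noteq> 0 \<or> u $ 2 * (w $ 1 - w $ 2) \<noteq> 0}"
      unfolding case_prod_beta by (intro open_Collect_disj open_Collect_neq continuous_intros)
    ultimately show "openin (top_of_set surface_cover) (T b)" by (simp add: openin_open_Int)
    have "continuous_map (top_of_set (T b)) proj_space (f b)"
    proof (cases b)
      case True
      then show ?thesis unfolding f_def case_prod_beta T_def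
        by simp (intro continuous_map_hom2 continuous_intros; auto)
    next
      case False
      then show ?thesis unfolding f_def case_prod_beta T_def
        by simp (intro continuous_map_hom2 continuous_intros; auto)
    qed
    then show "continuous_map (subtopology (top_of_set surface_cover) (T b)) proj_space (f b)"
      using T_sub[of b] by (simp add: subtopology_subtopology inf_absorb2)
  next
    fix b b' x assume "x \<in> topspace (top_of_set surface_cover) \<inter> T b \<inter> T b'"
    moreover obtain u v w where "x = (u, v, w)" by (cases x)
    ultimately show "f b x = f b' x"
      using ratio_alternative[of u v w]
      by (cases b; cases b') (auto simp: T_def f_def ratio_def split: if_splits)
  next
    fix x assume x: "x \<in> topspace (top_of_set surface_cover)"
    obtain u v w where "x = (u, v, w)" by (cases x)
    then show "\<exists>b. b \<in> UNIV \<and> x \<in> T b \<and> (case x of (u, v, w) \<Rightarrow> ratio u v w) = f b x"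
      using x ratio_defined[of u v w]
      by (cases "(v $ 1 - v $ 2) * w $ 2 = 0 \<and> (w $ 1 - w $ 2) * v $ 2 = 0")
        (auto simp: T_def f_def ratio_def intro: exI[of _ False] exI[of _ True])
  qed
qed

lemma flip_cover: "(u, v, w) \<in> surface_cover \<Longrightarrow> (flip u, flip v, flip w) \<in> surface_cover"
  by (auto simp: surface_cover_def)

abbreviation cp1_fifth :: "(cp1 \<times> cp1 \<times> cp1 \<times> cp1 \<times> cp1) topology" where
  "cp1_fifth \<equiv> prod_topology proj_space (prod_topology proj_space
     (prod_topology proj_space (prod_topology proj_space proj_space)))"

text \<open>For a point of the chart M_ij with remaining indices k1 < k2 < k3, the five entries are
  the cross-ratios omitting k3, k2, k1, i and j in this order.\<close>

definition cross_ratios :: "(complex^2) \<times> (complex^2) \<times> (complex^2) \<Rightarrow> cp1 \<times> cp1 \<times> cp1 \<times> cp1 \<times> cp1" where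
  "cross_ratios = (\<lambda>(u, v, w). (line u, line v, line w, ratio (flip u) (flip v) (flip w), ratio u v w))"

lemma continuous_on_flip [continuous_intros]: "continuous_on S f \<Longrightarrow> continuous_on S (\<lambda>x. flip (f x))"
  unfolding flip_def by (intro continuous_on_vector_2 continuous_intros)

lemma continuous_map_cross_ratios: "continuous_map (top_of_set surface_cover) cp1_fifth cross_ratios"
proof -
  have f: "continuous_map (top_of_set surface_cover) (top_of_set surface_cover) (\<lambda>(u, v, w). (flip u, flip v, flip w))"
    unfolding case_prod_beta
    by (simp, intro conjI continuous_intros) (auto intro: flip_cover)
  have "continuous_map (top_of_set surface_cover) (top_of_set (UNIV - {0})) (\<lambda>x. fst x)"
      "continuous_map (top_of_set surface_cover) (top_of_set (UNIV - {0})) (\<lambda>x. fst (snd x))"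
      "continuous_map (top_of_set surface_cover) (top_of_set (UNIV - {0})) (\<lambda>x. snd (snd x))"
    by (auto intro!: continuous_intros simp: surface_cover_def)
  note this[THEN continuous_map_compose, OF continuous_map_line, unfolded o_def]
  then show ?thesis
    using continuous_map_compose[OF f continuous_map_ratio] continuous_map_ratio
    unfolding cross_ratios_def case_prod_beta
    by (intro continuous_map_pairedI) (simp_all add: o_def)
qed

lemma lines_eqE:
  assumes "lines x = lines y" "x \<in> surface_cover"
  obtains a b c u v w where "a \<noteq> 0" "b \<noteq> 0" "c \<noteq> 0" "x = (a *s u, b *s v, c *s w)" "y = (u, v, w)"
proof -
  obtain u v w u' v' w' where xy: "x = (u', v', w')" "y = (u, v, w)" by (cases x, cases y)
  then have "line u' = line u" "line v' = line v" "line w' = line w" "u' \<noteq> 0" "v' \<noteq> 0" "w' \<noteq> 0"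
    using assms by (auto simp: lines_def surface_cover_def)
  then obtain a b c where "a \<noteq> 0" "b \<noteq> 0" "c \<noteq> 0" "u' = a *s u" "v' = b *s v" "w' = c *s w"
    by (metis line_eqE)
  then show thesis using that xy by blast
qed

lemma cross_ratios_cong:
  assumes "lines x = lines y" "x \<in> surface_cover"
  shows "cross_ratios x = cross_ratios y"
  using assms by (elim lines_eqE) (auto simp: cross_ratios_def flip_scale ratio_scale line_scale)

text \<open>\<open>surface\<close> asks for some representatives that satisfy the equation. The
  equation is homogeneous in each of the three vectors, so any representatives may be
  tested.\<close>

lemma in_surface_iff:
  assumes "u \<noteq> 0" "v \<noteq> 0" "w \<noteq> 0"
  shows "(line u, line v, line w) \<in> surface \<longleftrightarrow> u $ 1 * v $ 2 * w $ 1 = u $ 2 * v $ 1 * w $ 2"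
proof
  assume "u $ 1 * v $ 2 * w $ 1 = u $ 2 * v $ 1 * w $ 2"
  then show "(line u, line v, line w) \<in> surface"
    using assms unfolding surface_def line_conv_hom2 vec2_eq_0_iff by fastforce
next
  assume "(line u, line v, line w) \<in> surface"
  then obtain c1 c1' c2 c2' c3 c3' where
    eq: "line u = hom2 c1 c1'" "line v = hom2 c2 c2'" "line w = hom2 c3 c3'"
      "c1 * c2' * c3 = c1' * c2 * c3'" unfolding surface_def by blast
  obtain a where a: "a \<noteq> 0" "u = a *s vector [c1, c1']" using eq assms unfolding hom2_def by (metis line_eqE)
  obtain b where b: "b \<noteq> 0" "v = b *s vector [c2, c2']" using eq assms unfolding hom2_def by (metis line_eqE)
  obtain c where c: "c \<noteq> 0" "w = c *s vector [c3, c3']" using eq assms unfolding hom2_def by (metis line_eqE)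
  show "u $ 1 * v $ 2 * w $ 1 = u $ 2 * v $ 1 * w $ 2"
    using eq(4) a b c by (simp add: vector_2 mult_ac)
qed

lemma line_eq_hom2_1_1: "u \<noteq> 0 \<Longrightarrow> line u = hom2 1 1 \<longleftrightarrow> u $ 1 = u $ 2"
  unfolding line_conv_hom2 by (subst hom2_eq_iff) (auto simp: vec2_eq_0_iff)

abbreviation nonzero3 :: "((complex^2) \<times> (complex^2) \<times> (complex^2)) set" where
  "nonzero3 \<equiv> (UNIV - {0}) \<times> (UNIV - {0}) \<times> (UNIV - {0})"

lemma lines_in_iff: "x \<in> nonzero3 \<Longrightarrow> lines x \<in> surface - {center} \<longleftrightarrow> x \<in> surface_cover"
  by (cases x) (simp add: lines_def surface_cover_def in_surface_iff center_def line_eq_hom2_1_1)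

lemma surface_subset: "surface \<subseteq> lines ` nonzero3"
proof
  fix c assume "c \<in> surface"
  then obtain c1 c1' c2 c2' c3 c3' where
    c: "c = (hom2 c1 c1', hom2 c2 c2', hom2 c3 c3')" "(c1, c1') \<noteq> (0, 0)" "(c2, c2') \<noteq> (0, 0)" "(c3, c3') \<noteq> (0, 0)"
    unfolding surface_def by blast
  show "c \<in> lines ` nonzero3"
    by (rule image_eqI[of _ _ "(vector [c1, c1'], vector [c2, c2'], vector [c3, c3'])"])
      (use c in \<open>auto simp: lines_def hom2_def vector_2_eq_0_iff\<close>)
qed

lemma quotient_map_lines:
  "quotient_map (top_of_set surface_cover) (subtopology cp1_cubed (surface - {center})) lines"
proof -
  let ?N = "top_of_set (UNIV - {0 :: complex^2})"
  have top: "prod_topology ?N (prod_topology ?N ?N) = top_of_set nonzero3" by simp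
  have lines: "lines = (\<lambda>(u, vw). (line u, (\<lambda>(v, w). (line v, line w)) vw))"
    by (auto simp: lines_def)
  have "open_map (top_of_set nonzero3) cp1_cubed lines"
    unfolding top[symmetric] lines cp1_cubed_def by (intro open_map_prod open_map_line)
  moreover have "continuous_map (top_of_set nonzero3) cp1_cubed lines"
  proof -
    have "continuous_map (top_of_set nonzero3) ?N fst"
      "continuous_map (top_of_set nonzero3) ?N (\<lambda>x. fst (snd x))"
      "continuous_map (top_of_set nonzero3) ?N (\<lambda>x. snd (snd x))"
      by (auto intro!: continuous_intros)
    note this[THEN continuous_map_compose, OF continuous_map_line, unfolded o_def]
    then show ?thesis
      unfolding lines_def cp1_cubed_def case_prod_beta by (intro continuous_map_pairedI)
  qed
  ultimately have "quotient_map (subtopology (top_of_set nonzero3) {x \<in> topspace (top_of_set nonzero3). lines x \<in> surface - {center}})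
     (subtopology cp1_cubed (surface - {center})) lines"
    by (intro quotient_map_open_restriction) (use surface_subset in auto)
  moreover have "{x \<in> topspace (top_of_set nonzero3). lines x \<in> surface - {center}} = surface_cover"
    using lines_in_iff by (auto simp: surface_cover_def)
  moreover have "subtopology (top_of_set nonzero3) surface_cover = top_of_set surface_cover"
  proof -
    have "surface_cover \<subseteq> nonzero3" by (auto simp: surface_cover_def)
    then show ?thesis by (simp add: subtopology_subtopology inf_absorb2)
  qed
  ultimately show ?thesis by simp
qed

section \<open>The blowup over the affine part of the surface\<close>

definition affine_vectors :: "complex^3 \<Rightarrow> (complex^2) \<times> (complex^2) \<times> (complex^2)" where
  "affine_vectors z = (vector [z $ 1, 1], vector [z $ 2, 1], vector [z $ 3, 1])"

lemma affine_point_eq_lines: "affine_point z = lines (affine_vectors z)"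
  by (simp add: affine_point_def lines_def affine_vectors_def hom2_def)

lemma affine_point_in_surface_iff: "affine_point z \<in> surface \<longleftrightarrow> z $ 1 * z $ 3 = z $ 2"
  unfolding affine_point_eq_lines lines_def affine_vectors_def prod.case
  by (subst in_surface_iff) (auto simp: vector_2_eq_0_iff vector_2)

abbreviation affine_surface :: "(complex^3) set" where
  "affine_surface \<equiv> {z. affine_point z \<in> surface}"

abbreviation one3 :: "complex^3" where
  "one3 \<equiv> vector [1, 1, 1]"

lemma one3_nth: "one3 $ 1 = 1" "one3 $ 2 = 1" "one3 $ 3 = 1"
  by (simp_all add: vector_3)

lemma affine_point_eq_center_iff: "affine_point z = center \<longleftrightarrow> z = one3"
  by (simp add: affine_point_def center_def hom2_eq_iff vec3_eq_iff vector_3)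

lemma blowup_glue_eq:
  "blowup_glue (z, l) = (if z = one3 then Inr l else Inl (lines (affine_vectors z)))"
  by (simp only: blowup_glue_def prod.case affine_point_eq_center_iff) (simp only: affine_point_eq_lines)

text \<open>The counterpart of \<open>surface_cover\<close> for the affine blowup: the line in the
  second factor is replaced by a vector that spans it.\<close>

definition affine_cover :: "((complex^3) \<times> (complex^3)) set" where
  "affine_cover = {(z, v). z \<in> affine_surface \<and> v \<noteq> 0 \<and> (z, line v) \<in> topspace (affine_blowup affine_surface one3)}"

lemma affine_blowup_eq:
  "affine_blowup X a = subtopology (prod_topology (top_of_set X) proj_space)
     ((prod_topology (top_of_set X) proj_space) closure_of {(x, line (x - a)) | x. x \<in> X - {a}})"
  by (simp add: affine_blowup_def Let_def)

lemma topspace_affine_blowup: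
  "topspace (affine_blowup X a) =
     (prod_topology (top_of_set X) proj_space) closure_of {(x, line (x - a)) | x. x \<in> X - {a}}"
  unfolding affine_blowup_eq topspace_subtopology by (rule Int_absorb1[OF closure_of_subset_topspace])

lemma graph_in_affine_blowup:
  assumes "z \<in> X" "z \<noteq> a"
  shows "(z, line (z - a)) \<in> topspace (affine_blowup X a)"
  unfolding topspace_affine_blowup
  by (rule subsetD[OF closure_of_subset]) (use assms in auto)

lemma affine_coverI:
  assumes "z \<in> affine_surface" "z \<noteq> one3"
  shows "(z, z - one3) \<in> affine_cover"
  using assms graph_in_affine_blowup[OF assms] by (simp add: affine_cover_def)

lemma open_map_id_line:
  "open_map (top_of_set (X \<times> (UNIV - {0}))) (prod_topology (top_of_set X) proj_space) (\<lambda>(z, v). (z, line v))"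
proof -
  have "open_map (prod_topology (top_of_set X) (top_of_set (UNIV - {0})))
      (prod_topology (top_of_set X) proj_space) (\<lambda>(z, v). (id z, line v))"
    by (intro open_map_prod open_map_line open_map_id)
  then show ?thesis by simp
qed

lemma continuous_map_id_line:
  "continuous_map (top_of_set (X \<times> (UNIV - {0}))) (prod_topology (top_of_set X) proj_space) (\<lambda>(z, v). (z, line v))"
proof -
  have "continuous_map (top_of_set (X \<times> (UNIV - {0}))) (top_of_set X) fst"
    "continuous_map (top_of_set (X \<times> (UNIV - {0}))) (top_of_set (UNIV - {0})) snd"
    by (auto intro!: continuous_intros)
  then show ?thesis
    unfolding case_prod_beta
    by (intro continuous_map_pairedI) (auto intro: continuous_map_compose[OF _ continuous_map_line, unfolded o_def])
qed

lemma affine_cover_preimage: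
  "affine_cover = {x \<in> topspace (top_of_set (affine_surface \<times> (UNIV - {0}))).
     (\<lambda>(z, v). (z, line v)) x \<in> topspace (affine_blowup affine_surface one3)}"
  by (auto simp: affine_cover_def)

lemma affine_cover_subset: "affine_cover \<subseteq> affine_surface \<times> (UNIV - {0})"
  by (auto simp: affine_cover_def)

lemma quotient_map_affine_cover:
  "quotient_map (top_of_set affine_cover) (affine_blowup affine_surface one3) (\<lambda>(z, v). (z, line v))"
proof -
  let ?Y = "prod_topology (top_of_set affine_surface) proj_space :: ((complex^3) \<times> (complex^3) set) topology"
  let ?C = "topspace (affine_blowup affine_surface one3)"
  have "?C \<subseteq> (\<lambda>(z, v). (z, line v)) ` topspace (top_of_set (affine_surface \<times> (UNIV - {0})))"
  proof
    fix x assume "x \<in> ?C"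
    then have "x \<in> topspace ?Y"
      unfolding topspace_affine_blowup by (rule subsetD[OF closure_of_subset_topspace])
    then obtain z v where "x = (z, line v)" "z \<in> affine_surface" "v \<noteq> 0"
      by (auto simp: topspace_proj_space)
    then show "x \<in> (\<lambda>(z, v). (z, line v)) ` topspace (top_of_set (affine_surface \<times> (UNIV - {0})))" by force
  qed
  from quotient_map_open_restriction[OF continuous_map_id_line open_map_id_line this]
  have "quotient_map (subtopology (top_of_set (affine_surface \<times> (UNIV - {0}))) affine_cover)
     (subtopology ?Y ?C) (\<lambda>(z, v). (z, line v))"
    unfolding affine_cover_preimage .
  moreover have "subtopology ?Y ?C = affine_blowup affine_surface one3"
    unfolding topspace_affine_blowup unfolding affine_blowup_eq ..
  ultimately show ?thesis
    using affine_cover_subset by (simp add: subtopology_subtopology inf_absorb2)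
qed

text \<open>The strict transform: \<open>v\<close> is proportional to \<open>z - (1,1,1)\<close>, and the equation of the
  surface, written as \<open>z\<^sub>2 - 1 = (z\<^sub>1 - 1) z\<^sub>3 + (z\<^sub>3 - 1)\<close>, yields a linear equation for \<open>v\<close>.\<close>

lemma affine_cover_equations:
  assumes "(z, v) \<in> affine_cover"
  shows "v $ 2 = v $ 1 * z $ 3 + v $ 3" and "v $ i * (z $ j - 1) = v $ j * (z $ i - 1)"
proof -
  let ?E = "{(z, v). v $ 2 = v $ 1 * z $ 3 + v $ 3 \<and> (\<forall>i j. v $ i * (z $ j - 1) = v $ j * (z $ i - 1))}
    :: ((complex^3) \<times> (complex^3)) set"
  let ?Y = "prod_topology (top_of_set affine_surface) proj_space :: ((complex^3) \<times> (complex^3) set) topology"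
  let ?p = "\<lambda>(z :: complex^3, v :: complex^3). (z, line v)"
  let ?D = "affine_surface \<times> (UNIV - {0 :: complex^3})"
  let ?graph = "{(x, line (x - one3)) | x. x \<in> affine_surface - {one3}}"
  \<comment> \<open>The complement of \<open>?E\<close> is open and \<open>?p\<close> is an open
    map, so its image is open. This image misses the graph, since the equations are invariant under
    scaling of \<open>v\<close> and hold for \<open>v = z - one3\<close>; being open, it then misses
    the closure of the graph too.\<close>
  have "closed ?E"
    unfolding case_prod_beta by (intro closed_Collect_conj closed_Collect_all closed_Collect_eq continuous_intros)
  then have "openin (top_of_set ?D) (?D - ?E)"
    unfolding Diff_eq[of ?D] by (intro openin_open_Int open_Compl)
  then have op: "openin ?Y (?p ` (?D - ?E))"
    using open_map_id_line unfolding open_map_def by blast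
  have "?p ` (?D - ?E) \<inter> ?graph = {}"
  proof (rule ccontr)
    assume "?p ` (?D - ?E) \<inter> ?graph \<noteq> {}"
    then obtain z v where zv: "z \<in> affine_surface" "v \<noteq> 0" "(z, v) \<notin> ?E" "line v = line (z - one3)" by auto
    then obtain c where c: "v = c *s (z - one3)" by (metis line_eqE)
    have "one3 $ i = 1" for i using one3_nth exhaust_3[of i] by metis
    moreover have "z $ 2 = z $ 1 * z $ 3" using zv(1) by (simp add: affine_point_in_surface_iff)
    ultimately have "(z, v) \<in> ?E" unfolding c by (simp add: algebra_simps)
    then show False using zv(3) by blast
  qed
  then have "?p ` (?D - ?E) \<inter> ?Y closure_of ?graph = {}"
    by (simp only: openin_Int_closure_of_eq_empty[OF op])
  moreover have "(z, line v) \<in> ?Y closure_of ?graph" and "(z, v) \<in> ?D"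
    using assms affine_cover_subset by (auto simp: affine_cover_def topspace_affine_blowup)
  ultimately have "(z, v) \<in> ?E" by blast
  then show "v $ 2 = v $ 1 * z $ 3 + v $ 3" "v $ i * (z $ j - 1) = v $ j * (z $ i - 1)" by auto
qed

text \<open>If v2 = v3 = 0, then v1 is nonzero, so the linear equation gives z3 = 0 and thus z2 = 0,
  against v1 (z2 - 1) = v2 (z1 - 1). If v2 = z1 v3 = 0, then v3 is nonzero, so z1 = 0 and z2 = 0,
  against v2 (z3 - 1) = v3 (z2 - 1). These are the conditions under which the last two entries of
  \<open>affine_cross_ratios\<close> are points of CP^1.\<close>

lemma affine_cover_nondegenerate:
  assumes "(z, v) \<in> affine_cover"
  shows "v $ 2 \<noteq> 0 \<or> v $ 3 \<noteq> 0" and "v $ 2 \<noteq> 0 \<or> z $ 1 * v $ 3 \<noteq> 0"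
proof -
  have z: "z $ 1 * z $ 3 = z $ 2" and v: "v \<noteq> 0"
    using assms by (auto simp: affine_cover_def affine_point_in_surface_iff)
  note E = affine_cover_equations[OF assms]
  show 1: "v $ 2 \<noteq> 0 \<or> v $ 3 \<noteq> 0"
    using E(1) E(2)[of 1 2] z v by (auto simp: vec3_eq_iff)
  show "v $ 2 \<noteq> 0 \<or> z $ 1 * v $ 3 \<noteq> 0"
    using 1 E(2)[of 2 3] z by auto
qed

text \<open>Since \<open>v\<close> is proportional to z - (1,1,1), the fraction (z2 - 1 : z3 - 1)
  becomes (v2 : v3). Inverting the coordinates gives ((1 - z2) z3 : (1 - z3) z2), which is (v2 : z1
  v3) after z2 = z1 z3 is inserted and z3 is cancelled. Both stay meaningful at z = (1,1,1).\<close>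

definition affine_cross_ratios :: "(complex^3) \<times> (complex^3) \<Rightarrow> cp1 \<times> cp1 \<times> cp1 \<times> cp1 \<times> cp1" where
  "affine_cross_ratios = (\<lambda>(z, v). (hom2 (z $ 1) 1, hom2 (z $ 2) 1, hom2 (z $ 3) 1,
     hom2 (v $ 2) (z $ 1 * v $ 3), hom2 (v $ 2) (v $ 3)))"

lemma continuous_map_affine_cross_ratios:
  "continuous_map (top_of_set affine_cover) cp1_fifth affine_cross_ratios"
  unfolding affine_cross_ratios_def case_prod_beta
  by (intro continuous_map_pairedI continuous_map_hom2 continuous_intros)
    (use affine_cover_nondegenerate in auto)

lemma affine_cross_ratios_cong:
  assumes "(z, v) \<in> affine_cover" "line v = line w"
  shows "affine_cross_ratios (z, v) = affine_cross_ratios (z, w)"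
proof -
  have "v \<noteq> 0" using assms by (simp add: affine_cover_def)
  then obtain c where "c \<noteq> 0" "v = c *s w" using assms line_eqE by metis
  then show ?thesis
    using hom2_scale[of c "w $ 2" "w $ 3"] hom2_scale[of c "w $ 2" "z $ 1 * w $ 3"]
    by (simp add: affine_cross_ratios_def mult_ac)
qed

lemma affine_vectors_in_cover: "z \<in> affine_surface \<Longrightarrow> z \<noteq> one3 \<Longrightarrow> affine_vectors z \<in> surface_cover"
  by (auto simp: affine_vectors_def surface_cover_def vector_2_eq_0_iff vector_2 affine_point_in_surface_iff
      vec3_eq_iff vector_3)

lemma affine_cross_ratios_eq:
  assumes "(z, v) \<in> affine_cover" "z \<noteq> one3"
  shows "affine_cross_ratios (z, v) = cross_ratios (affine_vectors z)"
proof -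
  have z: "z $ 1 * z $ 3 = z $ 2"
    using assms by (auto simp: affine_cover_def affine_point_in_surface_iff)
  note E = affine_cover_equations[OF assms(1)]
  note nd = affine_cover_nondegenerate[OF assms(1)]
  have not1: "\<not> (z $ 2 = 1 \<and> z $ 3 = 1)" using assms(2) z by (auto simp: vec3_eq_iff vector_3)
  let ?u = "vector [z $ 1, 1] :: complex^2" and ?v = "vector [z $ 2, 1] :: complex^2"
    and ?w = "vector [z $ 3, 1] :: complex^2"
  have "ratio ?u ?v ?w = hom2 (z $ 2 - 1) (z $ 3 - 1)"
    using not1 by (auto simp: ratio_def vector_2)
  also have "\<dots> = hom2 (v $ 2) (v $ 3)"
    using not1 nd(1) E(2)[of 2 3] by (intro hom2_eqI) (auto simp: mult.commute)
  finally have 5: "ratio ?u ?v ?w = hom2 (v $ 2) (v $ 3)" .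
  \<comment> \<open>For the inverted coordinates the first pair of forms in \<open>ratio\<close>
    vanishes exactly where z2 = z3 = 0. There the second pair gives (1 : z1), and proportionality
    gives v2 = v3.\<close>
  have 4: "ratio (flip ?u) (flip ?v) (flip ?w) = hom2 (v $ 2) (z $ 1 * v $ 3)"
  proof (cases "(1 - z $ 2) * z $ 3 = 0 \<and> (1 - z $ 3) * z $ 2 = 0")
    case True
    then have z0: "z $ 2 = 0" "z $ 3 = 0" using not1 by auto
    then have "v $ 2 = v $ 3" using E(2)[of 2 3] by simp
    moreover from this have "v $ 3 \<noteq> 0" using nd by simp
    ultimately show ?thesis
      using z0 hom2_scale[of "v $ 3" 1 "z $ 1"] by (simp add: ratio_def vector_2 mult.commute)
  next
    case False
    then have "ratio (flip ?u) (flip ?v) (flip ?w) = hom2 ((1 - z $ 2) * z $ 3) ((1 - z $ 3) * z $ 2)"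
      by (auto simp: ratio_def vector_2)
    also have "\<dots> = hom2 (v $ 2) (z $ 1 * v $ 3)"
    proof (rule hom2_eqI)
      show "(1 - z $ 2) * z $ 3 * (z $ 1 * v $ 3) = (1 - z $ 3) * z $ 2 * v $ 2"
        using E(2)[of 2 3] z by algebra
    qed (use False nd(2) in auto)
    finally show ?thesis .
  qed
  show ?thesis
    using 4 5 by (simp add: affine_cross_ratios_def cross_ratios_def affine_vectors_def hom2_def)
qed

section \<open>The embedding of the blowup into a product of five projective lines\<close>

lemma blowup_Inl: "continuous_map (subtopology cp1_cubed (surface - {center})) blowup Inl"
  unfolding blowup_def by (rule continuous_map_glue_left)

lemma blowup_Inr: "continuous_map (affine_blowup affine_surface one3) blowup blowup_glue"
  unfolding blowup_def by (rule continuous_map_glue_right)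

lemma topspace_cp1_cubed_minus: "topspace (subtopology cp1_cubed (surface - {center})) = lines ` surface_cover"
  using quotient_imp_surjective_map[OF quotient_map_lines] by simp

lemma in_affine_blowupE:
  assumes "x \<in> topspace (affine_blowup affine_surface one3)"
  obtains z v where "(z, v) \<in> affine_cover" "x = (z, line v)"
proof -
  have "x \<in> (\<lambda>(z, v). (z, line v)) ` affine_cover"
    using assms quotient_imp_surjective_map[OF quotient_map_affine_cover] by simp
  then obtain y where y: "x = (\<lambda>(z, v). (z, line v)) y" "y \<in> affine_cover" by (rule imageE)
  obtain z v where "y = (z, v)" by (cases y)
  then show thesis using that[of z v] y by simp
qed

lemma topspace_blowup:
  "topspace blowup = Inl ` lines ` surface_cover \<union> {Inr (line v) | v. (one3, v) \<in> affine_cover}" (is "_ = ?L \<union> ?R")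
proof -
  have 1: "topspace blowup = ?L \<union> blowup_glue ` topspace (affine_blowup affine_surface one3)"
    unfolding blowup_def topspace_glue_topology topspace_cp1_cubed_minus ..
  have 2: "blowup_glue ` topspace (affine_blowup affine_surface one3) \<subseteq> ?L \<union> ?R"
  proof
    fix p assume "p \<in> blowup_glue ` topspace (affine_blowup affine_surface one3)"
    then obtain x where "p = blowup_glue x" "x \<in> topspace (affine_blowup affine_surface one3)" by (rule imageE)
    then obtain z v where v: "(z, v) \<in> affine_cover" "p = blowup_glue (z, line v)" by (auto elim: in_affine_blowupE)
    show "p \<in> ?L \<union> ?R"
    proof (cases "z = one3")
      case True
      then show ?thesis using v by (auto simp: blowup_glue_eq)
    next
      case False
      then have "affine_vectors z \<in> surface_cover"
        using v(1) affine_vectors_in_cover by (simp add: affine_cover_def)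
      then show ?thesis using False v(2) by (simp add: blowup_glue_eq)
    qed
  qed
  have 3: "?R \<subseteq> blowup_glue ` topspace (affine_blowup affine_surface one3)"
  proof clarify
    fix v assume "(one3, v) \<in> affine_cover"
    then have "(one3, line v) \<in> topspace (affine_blowup affine_surface one3)"
      by (simp add: affine_cover_def)
    then show "Inr (line v) \<in> blowup_glue ` topspace (affine_blowup affine_surface one3)"
      by (rule image_eqI[rotated]) (simp add: blowup_glue_eq)
  qed
  have "A = L \<union> R" if "A = L \<union> G" "G \<subseteq> L \<union> R" "R \<subseteq> G" for A G L R :: "blowup_point set"
    using that by blast
  from this[OF 1 2 3] show ?thesis .
qed

lemma Inl_lines_in_blowup: "x \<in> surface_cover \<Longrightarrow> Inl (lines x) \<in> topspace blowup"
  by (simp add: topspace_blowup)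

text \<open>The first three entries separate the points away from the exceptional divisor, and they
  are all (1:1) precisely on this divisor. Over (1,1,1) the equation of the strict transform reads
  v2 = v1 + v3, so the last entry (v2 : v3) determines the tangent direction.\<close>

lemma blowup_embedding:
  obtains \<Psi> where "continuous_map blowup cp1_fifth \<Psi>" "inj_on \<Psi> (topspace blowup)"
    "\<And>x. x \<in> surface_cover \<Longrightarrow> \<Psi> (Inl (lines x)) = cross_ratios x"
proof -
  obtain g where g: "continuous_map (subtopology cp1_cubed (surface - {center})) cp1_fifth g"
      "\<And>x. x \<in> surface_cover \<Longrightarrow> g (lines x) = cross_ratios x"
    using quotient_map_lift_exists[OF quotient_map_lines continuous_map_cross_ratios]
      cross_ratios_cong by (metis topspace_euclidean_subtopology)
  obtain g' where g': "continuous_map (affine_blowup affine_surface one3) cp1_fifth g'"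
      "\<And>z v. (z, v) \<in> affine_cover \<Longrightarrow> g' (z, line v) = affine_cross_ratios (z, v)"
  proof (rule quotient_map_lift_exists[OF quotient_map_affine_cover continuous_map_affine_cross_ratios])
    show "affine_cross_ratios x = affine_cross_ratios y"
      if "x \<in> topspace (top_of_set affine_cover)" "(case x of (z, v) \<Rightarrow> (z, line v)) = (case y of (z, v) \<Rightarrow> (z, line v))"
      for x y using that affine_cross_ratios_cong by (cases x; cases y) auto
  qed (use that in force)
  define \<Psi> where "\<Psi> = case_sum g (\<lambda>l. g' (one3, l))"
  have "continuous_map blowup cp1_fifth \<Psi>"
    unfolding blowup_def
  proof (rule continuous_map_glue_topology)
    show "continuous_map (subtopology cp1_cubed (surface - {center})) cp1_fifth (\<Psi> \<circ> Inl)"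
      using g(1) by (simp add: \<Psi>_def o_def)
    show "continuous_map (affine_blowup affine_surface one3) cp1_fifth (\<Psi> \<circ> blowup_glue)"
    proof (rule continuous_map_eq[OF g'(1)])
      fix x assume "x \<in> topspace (affine_blowup affine_surface one3)"
      then obtain z v where x: "x = (z, line v)" "(z, v) \<in> affine_cover" by (auto elim: in_affine_blowupE)
      show "g' x = (\<Psi> \<circ> blowup_glue) x"
      proof (cases "z = one3")
        case True
        then show ?thesis using x by (simp add: \<Psi>_def blowup_glue_eq)
      next
        case False
        then have "affine_vectors z \<in> surface_cover"
          using x(2) by (auto intro: affine_vectors_in_cover simp: affine_cover_def)
        then show ?thesis
          using x False g(2) g'(2) affine_cross_ratios_eq
          by (simp add: \<Psi>_def blowup_glue_eq)
      qed
    qed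
  qed
  moreover have "inj_on \<Psi> (topspace blowup)"
  proof -
    have l: "fst (cross_ratios x) = fst (lines x)" "fst (snd (cross_ratios x)) = fst (snd (lines x))"
      "fst (snd (snd (cross_ratios x))) = snd (snd (lines x))" for x
      by (auto simp: cross_ratios_def lines_def split: prod.split)
    have 1: "lines x = lines y" if "x \<in> surface_cover" "y \<in> surface_cover" "g (lines x) = g (lines y)" for x y
      using that g(2) l[of x] l[of y] by (simp add: prod_eq_iff)
    have 2: False if "x \<in> surface_cover" "(one3, v) \<in> affine_cover" "g (lines x) = g' (one3, line v)" for x v
    proof -
      have "lines x = center"
        using that g(2) g'(2) l[of x] by (simp add: prod_eq_iff affine_cross_ratios_def center_def vector_3)
      moreover have "x \<in> nonzero3" using that by (auto simp: surface_cover_def)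
      ultimately show False using lines_in_iff[of x] that(1) by simp
    qed
    have 3: "line v = line w" if v: "(one3, v) \<in> affine_cover" and w: "(one3, w) \<in> affine_cover"
      and eq: "g' (one3, line v) = g' (one3, line w)" for v w
    proof -
      have "hom2 (v $ 2) (v $ 3) = hom2 (w $ 2) (w $ 3)"
        using eq v w by (simp add: g'(2) affine_cross_ratios_def)
      then have "line (vector [v $ 2, v $ 3] :: complex^2) = line (vector [w $ 2, w $ 3])"
        by (simp add: hom2_def)
      moreover have "(vector [v $ 2, v $ 3] :: complex^2) \<noteq> 0"
        using affine_cover_nondegenerate(1)[OF v] by (simp add: vector_2_eq_0_iff)
      ultimately obtain c where c: "c \<noteq> 0" "(vector [v $ 2, v $ 3] :: complex^2) = c *s vector [w $ 2, w $ 3]"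
        by (metis line_eqE)
      then have "v $ 2 = c * w $ 2" "v $ 3 = c * w $ 3" by (simp_all add: vec_eq_iff forall_2 vector_2)
      moreover have "v $ 2 = v $ 1 + v $ 3" "w $ 2 = w $ 1 + w $ 3"
        using affine_cover_equations(1)[OF v] affine_cover_equations(1)[OF w] by (simp_all add: vector_3)
      ultimately have "v = c *s w" by (simp add: vec3_eq_iff algebra_simps)
      then show ?thesis using c(1) by (simp add: line_scale)
    qed
    show ?thesis
      unfolding inj_on_def topspace_blowup
    proof clarify
      fix p q assume "p \<in> Inl ` lines ` surface_cover \<union> {Inr (line v) | v. (one3, v) \<in> affine_cover}"
        "q \<in> Inl ` lines ` surface_cover \<union> {Inr (line v) | v. (one3, v) \<in> affine_cover}" and eq: "\<Psi> p = \<Psi> q"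
      then consider (a) x y where "p = Inl (lines x)" "q = Inl (lines y)" "x \<in> surface_cover" "y \<in> surface_cover"
        | (b) x v where "p = Inl (lines x)" "q = Inr (line v)" "x \<in> surface_cover" "(one3, v) \<in> affine_cover"
        | (c) x v where "p = Inr (line v)" "q = Inl (lines x)" "x \<in> surface_cover" "(one3, v) \<in> affine_cover"
        | (d) v w where "p = Inr (line v)" "q = Inr (line w)" "(one3, v) \<in> affine_cover" "(one3, w) \<in> affine_cover"
        by fastforce
      then show "p = q"
      proof cases
        case a
        then show ?thesis using eq 1[of x y] by (simp add: \<Psi>_def)
      next
        case b
        then show ?thesis using eq 2[of x v] by (simp add: \<Psi>_def)
      next
        case c
        then show ?thesis using eq 2[of x v] by (simp add: \<Psi>_def)
      next
        case d
        then show ?thesis using eq 3[of v w] by (simp add: \<Psi>_def)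
      qed
    qed
  qed
  moreover have "\<Psi> (Inl (lines x)) = cross_ratios x" if "x \<in> surface_cover" for x
    using g(2)[OF that] by (simp add: \<Psi>_def)
  ultimately show thesis by (rule that)
qed

section \<open>Compactness of the blowup\<close>

lemma compactin_blowup_Inl: 
  assumes "compact K" "K \<subseteq> surface_cover"
  shows "compactin blowup (Inl ` lines ` K)"
proof -
  have "compactin (top_of_set surface_cover) K" using assms by (simp add: compactin_subtopology)
  then show ?thesis
    by (intro image_compactin[OF _ blowup_Inl]
        image_compactin[OF _ quotient_imp_continuous_map[OF quotient_map_lines]])
qed

lemma compactin_blowup_glue: 
  assumes "compact K" "K \<subseteq> affine_cover"
  shows "compactin blowup (blowup_glue ` (\<lambda>(z, v). (z, line v)) ` K)"
proof -
  have "compactin (top_of_set affine_cover) K" using assms by (simp add: compactin_subtopology)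
  then show ?thesis
    by (intro image_compactin[OF _ blowup_Inr]
        image_compactin[OF _ quotient_imp_continuous_map[OF quotient_map_affine_cover]])
qed

lemma unit_representative:
  fixes v :: "complex^'n"
  assumes "v \<noteq> 0"
  obtains w where "norm w = 1" "line w = line v"
proof -
  have "complex_of_real (inverse (norm v)) *s v = inverse (norm v) *\<^sub>R v"
    by (simp add: vec_eq_iff) (simp add: scaleR_conv_of_real)
  then have "line v = line (inverse (norm v) *\<^sub>R v)"
    using line_scale[of "complex_of_real (inverse (norm v))" v] assms by simp
  then show thesis using assms that[of "inverse (norm v) *\<^sub>R v"] by simp
qed

text \<open>From 1 \<le> |u1| + |u2| and |u1| < 1/2 + |u2| it follows that |u2| \<ge> 1/4, while
  |u1| \<le> 1; hence the bound 4.\<close>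

lemma near_diagonal:
  fixes u :: "complex^2"
  assumes "norm u = 1" "norm (u $ 1 - u $ 2) < 1/2"
  shows "u $ 2 \<noteq> 0" "norm (u $ 1 / u $ 2) \<le> 4"
proof -
  have "norm u \<le> (\<Sum>i\<in>UNIV. norm (u $ i))"
    unfolding norm_vec_def by (rule L2_set_le_sum) simp
  then have "norm u \<le> norm (u $ 1) + norm (u $ 2)" by (simp add: sum_2)
  moreover have "norm (u $ 1) \<le> norm (u $ 1 - u $ 2) + norm (u $ 2)"
    using norm_triangle_ineq[of "u $ 1 - u $ 2" "u $ 2"] by simp
  ultimately have 2: "1/4 \<le> norm (u $ 2)" using assms by simp
  then show "u $ 2 \<noteq> 0" by auto
  have "norm (u $ 1) \<le> 1" using Finite_Cartesian_Product.norm_nth_le[of u 1] assms by simp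
  then show "norm (u $ 1 / u $ 2) \<le> 4"
    using 2 by (simp add: norm_divide divide_le_eq)
qed

text \<open>Two compact sets of vectors cover the blowup. \<open>K\<close> consists of unit vectors
  with at least one coordinate away from (1:1), hence away from the center. If all three coordinates
  are close to (1:1), the point has affine coordinates of modulus at most 4, and \<open>K'\<close>
  covers these points as well as the exceptional divisor.\<close>

lemma compact_space_blowup: "compact_space blowup"
proof -
  define K where "K = (sphere 0 1 \<times> sphere 0 1 \<times> sphere 0 1) \<inter>
    {(u :: complex^2, v :: complex^2, w :: complex^2). u $ 1 * v $ 2 * w $ 1 = u $ 2 * v $ 1 * w $ 2 \<and>
     (1/2 \<le> norm (u $ 1 - u $ 2) \<or> 1/2 \<le> norm (v $ 1 - v $ 2) \<or> 1/2 \<le> norm (w $ 1 - w $ 2))}"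
  have "compact K"
    unfolding K_def case_prod_beta
    by (intro compact_Int_closed compact_Times compact_sphere closed_Collect_conj closed_Collect_disj
        closed_Collect_eq closed_Collect_le continuous_intros)
  moreover have "K \<subseteq> surface_cover"
    by (auto simp: K_def surface_cover_def)
  ultimately have cK: "compactin blowup (Inl ` lines ` K)" by (rule compactin_blowup_Inl)
  define K' where "K' = affine_cover \<inter> ((affine_surface \<inter> {z. \<forall>i. norm (z $ i) \<le> 4}) \<times> sphere 0 1)"
  have "closed affine_surface"
    unfolding affine_point_in_surface_iff by (intro closed_Collect_eq continuous_intros)
  moreover have "compact {z :: complex^3. \<forall>i. norm (z $ i) \<le> 4}"
  proof -
    have "norm z \<le> 12" if "\<forall>i. norm (z $ i) \<le> 4" for z :: "complex^3"
    proof -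
      have "norm z \<le> (\<Sum>i\<in>UNIV. norm (z $ i))"
        unfolding norm_vec_def by (rule L2_set_le_sum) simp
      also have "\<dots> \<le> 12" using that by (simp add: sum_3 forall_3)
      finally show ?thesis .
    qed
    then have "bounded {z :: complex^3. \<forall>i. norm (z $ i) \<le> 4}" by (auto simp: bounded_iff)
    moreover have "closed {z :: complex^3. \<forall>i. norm (z $ i) \<le> 4}"
      by (intro closed_Collect_all closed_Collect_le continuous_intros)
    ultimately show ?thesis by (simp add: compact_eq_bounded_closed)
  qed
  ultimately have "compact ((affine_surface \<inter> {z. \<forall>i. norm (z $ i) \<le> 4}) \<times> sphere (0 :: complex^3) 1)" (is "compact ?R")
    by (intro compact_Times closed_Int_compact compact_sphere)
  \<comment> \<open>\<open>affine_cover\<close> is closed only relative to the pairs with a nonzero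
    vector. The compact set \<open>?R\<close> of pairs with a unit vector lies among them, so its
    intersection with \<open>affine_cover\<close> is compact.\<close>
  moreover have "closedin (top_of_set (affine_surface \<times> (UNIV - {0}))) affine_cover"
    unfolding affine_cover_preimage topspace_affine_blowup
    by (rule closedin_continuous_map_preimage[OF continuous_map_id_line closedin_closure_of])
  ultimately have "compact K'"
  proof -
    obtain T where T: "closed T" "affine_cover = (affine_surface \<times> (UNIV - {0})) \<inter> T"
      using \<open>closedin _ affine_cover\<close> by (auto simp: closedin_closed)
    then have "K' = T \<inter> ?R" by (auto simp: K'_def)
    then show ?thesis using T(1) \<open>compact ?R\<close> by (simp add: closed_Int_compact)
  qed
  then have cK': "compactin blowup (blowup_glue ` (\<lambda>(z, v). (z, line v)) ` K')"
    by (rule compactin_blowup_glue) (auto simp: K'_def)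
  have glue_K': "blowup_glue (z, line v) \<in> blowup_glue ` (\<lambda>(z, v). (z, line v)) ` K'"
    if zv: "(z, v) \<in> affine_cover" and "\<forall>i. norm (z $ i) \<le> 4" for z v
  proof -
    have "v \<noteq> 0" using zv by (simp add: affine_cover_def)
    then obtain w where "norm w = 1" "line w = line v" by (rule unit_representative)
    then have "(z, w) \<in> K'" using that by (auto simp: K'_def affine_cover_def)
    then show ?thesis
      using \<open>line w = line v\<close> by (intro imageI image_eqI[of _ _ "(z, w)"]) simp_all
  qed
  have "topspace blowup \<subseteq> Inl ` lines ` K \<union> blowup_glue ` (\<lambda>(z, v). (z, line v)) ` K'"
    unfolding topspace_blowup
  proof (intro Un_least subsetI)
    fix p :: blowup_point assume "p \<in> Inl ` lines ` surface_cover"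
    then obtain u0 v0 w0 where p: "p = Inl (lines (u0, v0, w0))" "(u0, v0, w0) \<in> surface_cover" by auto
    then have nz: "u0 \<noteq> 0" "v0 \<noteq> 0" "w0 \<noteq> 0" by (auto simp: surface_cover_def)
    obtain u where u: "norm u = 1" "line u = line u0" using unit_representative[OF nz(1)] .
    obtain v where v: "norm v = 1" "line v = line v0" using unit_representative[OF nz(2)] .
    obtain w where w: "norm w = 1" "line w = line w0" using unit_representative[OF nz(3)] .
    have p': "p = Inl (lines (u, v, w))" using p u v w by (simp add: lines_def)
    have nz': "u \<noteq> 0" "v \<noteq> 0" "w \<noteq> 0" using u v w by auto
    have "lines (u, v, w) = lines (u0, v0, w0)" using u v w by (simp add: lines_def)
    then have uvw: "(u, v, w) \<in> surface_cover"
      using lines_in_iff[of "(u, v, w)"] lines_in_iff[of "(u0, v0, w0)"] p(2) nz nz' by simp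
    show "p \<in> Inl ` lines ` K \<union> blowup_glue ` (\<lambda>(z, v). (z, line v)) ` K'"
    proof (cases "(u, v, w) \<in> K")
      case True
      then show ?thesis using p' by blast
    next
      case False
      then have *: "norm (u $ 1 - u $ 2) < 1/2" "norm (v $ 1 - v $ 2) < 1/2" "norm (w $ 1 - w $ 2) < 1/2"
        using uvw u v w by (auto simp: K_def surface_cover_def)
      note nd = near_diagonal[OF u(1) *(1)] near_diagonal[OF v(1) *(2)] near_diagonal[OF w(1) *(3)]
      define z :: "complex^3" where "z = vector [u $ 1 / u $ 2, v $ 1 / v $ 2, w $ 1 / w $ 2]"
      have "lines (affine_vectors z) = lines (u, v, w)"
        using nd by (simp add: lines_def affine_vectors_def z_def vector_3 line_conv_hom2 vector_2 hom2_eq_iff)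
      then have z: "affine_point z = lines (u, v, w)" by (simp add: affine_point_eq_lines)
      have "lines (u, v, w) \<in> surface - {center}"
        using lines_in_iff[of "(u, v, w)"] uvw nz' by simp
      then have "z \<in> affine_surface" "z \<noteq> one3"
        using z affine_point_eq_center_iff[of z] by auto
      then have "(z, z - one3) \<in> affine_cover" by (rule affine_coverI)
      moreover have "\<forall>i. norm (z $ i) \<le> 4"
        using nd by (simp add: forall_3 z_def vector_3)
      ultimately have "blowup_glue (z, line (z - one3)) \<in> blowup_glue ` (\<lambda>(z, v). (z, line v)) ` K'"
        by (rule glue_K')
      then show ?thesis
        using \<open>z \<noteq> one3\<close> z p' by (simp add: blowup_glue_eq affine_point_eq_lines)
    qed
  next
    fix p :: blowup_point assume "p \<in> {Inr (line v) | v. (one3, v) \<in> affine_cover}"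
    then obtain v where v: "p = Inr (line v)" "(one3, v) \<in> affine_cover" by blast
    have "p = blowup_glue (one3, line v)"
      using v by (simp add: blowup_glue_eq)
    then show "p \<in> Inl ` lines ` K \<union> blowup_glue ` (\<lambda>(z, v). (z, line v)) ` K'"
      using glue_K'[OF v(2)] by (simp add: forall_3 vector_3)
  qed
  moreover have "Inl ` lines ` K \<union> blowup_glue ` (\<lambda>(z, v). (z, line v)) ` K' \<subseteq> topspace blowup"
    using compactin_subset_topspace[OF cK] compactin_subset_topspace[OF cK'] by blast
  ultimately show ?thesis
    using compactin_Un[OF cK cK'] by (simp add: compact_space_def subset_antisym)
qed

section \<open>Cross-ratios and the charts of the Grassmannian\<close>

text \<open>\<open>minor\<close> sorts its two indices; the antisymmetric version satisfies the
  Pluecker relation for indices in any order.\<close>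

definition signed_minor :: "complex^2^5 \<Rightarrow> 5 \<Rightarrow> 5 \<Rightarrow> complex" where
  "signed_minor A p q = A $ p $ 1 * A $ q $ 2 - A $ p $ 2 * A $ q $ 1"

lemma signed_minor_swap: "signed_minor A q p = - signed_minor A p q"
  by (simp add: signed_minor_def)

text \<open>The three-term Pluecker relation. In terms of a cross-ratio x it identifies x - 1 as a
  quotient of products of minors.\<close>

lemma signed_minor_pluecker:
  "signed_minor A p r * signed_minor A q s - signed_minor A p s * signed_minor A q r =
     signed_minor A p q * signed_minor A r s"
  by (simp add: signed_minor_def algebra_simps)

lemma minor_eq_signed_minor: "p < q \<Longrightarrow> minor A {p, q} = signed_minor A p q"
  by (simp add: minor_def signed_minor_def min_def max_def less_imp_le)

lemma all_minors_nonzero_iff: "(\<forall>I\<in>pairs. minor A I \<noteq> 0) \<longleftrightarrow> (\<forall>p q. p \<noteq> q \<longrightarrow> signed_minor A p q \<noteq> 0)"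
proof (intro iffI allI impI ballI)
  fix p q :: 5 assume *: "\<forall>I\<in>pairs. minor A I \<noteq> 0" "p \<noteq> q"
  then have "minor A {p, q} \<noteq> 0" "minor A {q, p} \<noteq> 0" by (auto simp: pairs_def)
  then show "signed_minor A p q \<noteq> 0"
    using \<open>p \<noteq> q\<close> minor_eq_signed_minor[of p q A] minor_eq_signed_minor[of q p A] signed_minor_swap[of A p q]
    by (cases p q rule: linorder_cases) auto
next
  fix I assume *: "\<forall>p q. p \<noteq> q \<longrightarrow> signed_minor A p q \<noteq> 0" "I \<in> pairs"
  then obtain p q where "I = {p, q}" "p \<noteq> q" by (auto simp: pairs_def card_2_iff)
  then show "minor A I \<noteq> 0"
    using * minor_eq_signed_minor[of p q A] minor_eq_signed_minor[of q p A]
    by (cases p q rule: linorder_cases) (auto simp: insert_commute)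
qed

lemma matrix_vector_mult_2: "(A *v v) $ p = A $ p $ 1 * v $ 1 + A $ p $ 2 * v $ 2"
  for A :: "complex^2^'n"
  by (simp add: matrix_vector_mult_def sum_2)

lemma in_column_space_iff:
  "x \<in> column_space A \<longleftrightarrow> (\<exists>a b. \<forall>p. x $ p = A $ p $ 1 * a + A $ p $ 2 * b)"
proof
  assume "x \<in> column_space A"
  then obtain v where "x = A *v v" by (auto simp: column_space_def)
  then have "\<forall>p. x $ p = A $ p $ 1 * v $ 1 + A $ p $ 2 * v $ 2" by (simp add: matrix_vector_mult_2)
  then show "\<exists>a b. \<forall>p. x $ p = A $ p $ 1 * a + A $ p $ 2 * b" by blast
next
  assume "\<exists>a b. \<forall>p. x $ p = A $ p $ 1 * a + A $ p $ 2 * b"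
  then obtain a b where "\<forall>p. x $ p = A $ p $ 1 * a + A $ p $ 2 * b" by blast
  then have "x = A *v vector [a, b]" by (simp add: vec_eq_iff matrix_vector_mult_2 vector_2)
  then show "x \<in> column_space A" by (simp add: column_space_def)
qed

lemma column_space_nth:
  "(\<chi> p. A $ p $ 1) \<in> column_space A" "(\<chi> p. A $ p $ 2) \<in> column_space A"
  unfolding in_column_space_iff
  by (rule exI[of _ 1], rule exI[of _ 0], simp) (rule exI[of _ 0], rule exI[of _ 1], simp)

text \<open>The columns of \<open>A\<close> are combinations of those of \<open>B\<close>, and
  \<open>d\<close> is the determinant of the coefficients. Thus Pluecker coordinates do not depend
  on the chosen basis, up to a common factor.\<close>

lemma signed_minor_column_space:
  assumes "column_space A \<subseteq> column_space B"
  shows "\<exists>d. \<forall>p q. signed_minor A p q = d * signed_minor B p q"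
proof -
  obtain a b where ab: "\<And>p. A $ p $ 1 = B $ p $ 1 * a + B $ p $ 2 * b"
    using subsetD[OF assms column_space_nth(1)[of A]] unfolding in_column_space_iff by auto
  obtain c d where cd: "\<And>p. A $ p $ 2 = B $ p $ 1 * c + B $ p $ 2 * d"
    using subsetD[OF assms column_space_nth(2)[of A]] unfolding in_column_space_iff by auto
  have "signed_minor A p q = (a * d - b * c) * signed_minor B p q" for p q
    unfolding signed_minor_def ab cd by (simp add: algebra_simps)
  then show ?thesis by blast
qed

lemma full_rankI:
  assumes "signed_minor A p q \<noteq> 0"
  shows "A \<in> full_rank"
proof -
  have "v = w" if "A *v v = A *v w" for v w
  proof -
    have "A $ r $ 1 * (v $ 1 - w $ 1) + A $ r $ 2 * (v $ 2 - w $ 2) = 0" for r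
      using that by (simp add: vec_eq_iff matrix_vector_mult_2 algebra_simps)
    from this[of p] this[of q] have "signed_minor A p q * (v $ 1 - w $ 1) = 0" "signed_minor A p q * (v $ 2 - w $ 2) = 0"
      unfolding signed_minor_def by algebra+
    then show "v = w" using assms by (simp add: vec_eq_iff forall_2)
  qed
  then show ?thesis by (auto simp: full_rank_def inj_on_def)
qed

lemma column_space_two_planes: "A \<in> full_rank \<Longrightarrow> column_space A \<in> two_planes"
proof -
  assume "A \<in> full_rank"
  then have "vec.dim (range (\<lambda>v. A *v v)) = vec.dim (UNIV :: (complex^2) set)"
    by (intro vec.dim_image_eq) (auto simp: full_rank_def inj_on_def)
  moreover have "vec.subspace (range (\<lambda>v. A *v v))"
    by (intro vec.subspace_image) (auto intro: vec.subspace_UNIV)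
  moreover have "vec.dim (UNIV :: (complex^2) set) = CARD(2)" by (rule vec_dim_card)
  ultimately show ?thesis unfolding two_planes_def column_space_def by simp
qed

lemma two_planes_column_space:
  assumes "L \<in> two_planes"
  obtains A where "A \<in> full_rank" "column_space A = L"
proof -
  have L: "vec.subspace L" "vec.dim L = 2" using assms by (auto simp: two_planes_def)
  obtain B where B: "B \<subseteq> L" "vec.independent B" "L \<subseteq> vec.span B" "card B = 2"
    using vec.basis_exists[of L] L by metis
  then obtain x y where xy: "B = {x, y}" "x \<noteq> y" by (auto simp: card_2_iff)
  have LB: "L = vec.span {x, y}" using B L vec.span_minimal[of B L] xy by auto
  define A :: "complex^2^5" where "A = (\<chi> p. vector [x $ p, y $ p])"
  have Av: "A *v v = v $ 1 *s x + v $ 2 *s y" for v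
    by (simp add: vec_eq_iff matrix_vector_mult_2 A_def vector_2 mult.commute)
  have "column_space A = L"
  proof (intro set_eqI iffI)
    fix w assume "w \<in> column_space A"
    then show "w \<in> L"
      unfolding column_space_def LB Av
      by (elim rangeE, simp only:, intro vec.span_add vec.span_scale vec.span_base) simp_all
  next
    fix w assume "w \<in> L"
    then obtain a b where "w - a *s x = b *s y"
      unfolding LB by (auto simp: vec.span_insert vec.span_singleton)
    then have "w = A *v vector [a, b]" unfolding Av by (simp add: vector_2 algebra_simps)
    then show "w \<in> column_space A" by (simp add: column_space_def)
  qed
  moreover have "A \<in> full_rank"
  proof -
    have nx: "x \<notin> vec.span {y}" and ny: "y \<notin> vec.span {x}"
      using B(2) xy by (auto simp: vec.dependent_def insert_Diff_if)
    have "v = 0" if "A *v v = 0" for v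
    proof (rule ccontr)
      assume "v \<noteq> 0"
      have eq: "v $ 1 *s x = - (v $ 2) *s y" "v $ 2 *s y = - (v $ 1) *s x"
        using that unfolding Av by (simp_all add: add_eq_0_iff add_eq_0_iff2)
      show False
      proof (cases "v $ 1 = 0")
        case True
        then have "v $ 2 \<noteq> 0" using \<open>v \<noteq> 0\<close> by (simp add: vec_eq_iff forall_2)
        then have "y = 0" using eq(2) True by simp
        then show False using ny by (simp add: vec.span_zero)
      next
        case False
        then have "x = (1 / v $ 1) *s (v $ 1 *s x)" by (simp add: vector_smult_assoc)
        also have "\<dots> \<in> vec.span {y}" unfolding eq(1) by (intro vec.span_scale vec.span_base) simp
        finally show False using nx by blast
      qed
    qed
    then show ?thesis
      unfolding full_rank_def using vec.inj_iff_eq_0[of A] by simp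
  qed
  ultimately show thesis using that by blast
qed

lemma frame_full_rank: "L \<in> two_planes \<Longrightarrow> frame L \<in> full_rank \<and> column_space (frame L) = L"
proof -
  assume "L \<in> two_planes"
  then obtain A where "A \<in> full_rank" "column_space A = L" by (rule two_planes_column_space)
  then show ?thesis
    unfolding frame_def by (intro someI[of "\<lambda>A. A \<in> full_rank \<and> column_space A = L"] conjI)
qed

section \<open>Generic matrices, cross-ratios and chart coordinates\<close>

definition generic :: "complex^2^5 \<Rightarrow> bool" where
  "generic A \<longleftrightarrow> (\<forall>p q. p \<noteq> q \<longrightarrow> signed_minor A p q \<noteq> 0)"

lemma genericD: "generic A \<Longrightarrow> p \<noteq> q \<Longrightarrow> signed_minor A p q \<noteq> 0"
  by (simp add: generic_def)

lemma main_stratum_frame: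
  assumes "L \<in> main_stratum"
  shows "generic (frame L)" "column_space (frame L) = L"
  using assms frame_full_rank[of L] all_minors_nonzero_iff[of "frame L"]
  by (simp_all add: main_stratum_def plucker_def generic_def)

text \<open>The strata are defined through the chosen basis \<open>frame\<close>. Its minors differ
  from those of \<open>A\<close> by a common factor, which cannot be zero here.\<close>

lemma main_stratumI:
  assumes "generic A"
  shows "column_space A \<in> main_stratum"
proof -
  have L: "column_space A \<in> two_planes"
    using full_rankI genericD[OF assms, of 0 1] by (intro column_space_two_planes) auto
  obtain d where "\<And>p q. signed_minor A p q = d * signed_minor (frame (column_space A)) p q"
    using signed_minor_column_space[of A "frame (column_space A)"] frame_full_rank[OF L] by auto
  then have "generic (frame (column_space A))" using assms by (auto simp: generic_def)
  then show ?thesis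
    using L all_minors_nonzero_iff by (simp add: main_stratum_def plucker_def generic_def)
qed

text \<open>Homogeneous coordinates of the cross-ratio of the rows p, q, r, s. As a vector it is a
  lift of a chart coordinate, and reordering the rows acts on it by a linear map.\<close>

definition cr_vec :: "complex^2^5 \<Rightarrow> 5 \<Rightarrow> 5 \<Rightarrow> 5 \<Rightarrow> 5 \<Rightarrow> complex^2" where
  "cr_vec A p q r s = vector [signed_minor A p r * signed_minor A q s, signed_minor A p s * signed_minor A q r]"

lemma cr_vec_nth [simp]:
  "cr_vec A p q r s $ 1 = signed_minor A p r * signed_minor A q s" "cr_vec A p q r s $ 2 = signed_minor A p s * signed_minor A q r"
  by (simp_all add: cr_vec_def vector_2)

definition cross_ratio :: "5 \<Rightarrow> 5 \<Rightarrow> 5 \<Rightarrow> 5 \<Rightarrow> (complex^5) set \<Rightarrow> cp1" where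
  "cross_ratio p q r s L = line (cr_vec (frame L) p q r s)"

lemma cross_ratio_column_space:
  assumes "generic A"
  shows "cross_ratio p q r s (column_space A) = line (cr_vec A p q r s)"
proof -
  let ?F = "frame (column_space A)"
  obtain d where d: "\<And>p q. signed_minor A p q = d * signed_minor ?F p q"
    using signed_minor_column_space[of A ?F] main_stratum_frame(2)[OF main_stratumI[OF assms]] by auto
  then have "d \<noteq> 0" using genericD[OF assms, of 0 1] by auto
  moreover have "cr_vec A p q r s = (d * d) *s cr_vec ?F p q r s"
    by (simp add: vec_eq_iff forall_2 d)
  ultimately show ?thesis by (simp add: cross_ratio_def line_scale)
qed

lemma cross_ratio_conv_hom2:
  "generic A \<Longrightarrow> cross_ratio p q r s (column_space A) = hom2 (signed_minor A p r * signed_minor A q s) (signed_minor A p s * signed_minor A q r)"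
  by (simp add: cross_ratio_column_space line_conv_hom2)

lemma chart_matrix:
  assumes L: "L \<in> main_stratum" and "i \<noteq> j"
  shows "column_space (chart_matrix i j L) = L \<and> chart_matrix i j L $ i = vector [1, 0] \<and>
     chart_matrix i j L $ j = vector [0, 1]"
  unfolding chart_matrix_def
proof (rule theI)
  let ?F = "frame L" and ?D = "signed_minor (frame L) i j"
  \<comment> \<open>Cramer's rule for the product of the frame with the inverse of its block of rows
    i and j.\<close>
  let ?A = "(\<chi> p. vector [signed_minor ?F p j / ?D, signed_minor ?F i p / ?D]) :: complex^2^5"
  have D: "?D \<noteq> 0" using main_stratum_frame(1)[OF L] genericD assms(2) by blast
  have "column_space ?A = column_space ?F"
  proof (intro set_eqI iffI)
    fix x assume "x \<in> column_space ?A"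
    then obtain a b where ab: "\<And>p. x $ p = signed_minor ?F p j / ?D * a + signed_minor ?F i p / ?D * b"
      by (auto simp: in_column_space_iff vector_2)
    show "x \<in> column_space ?F"
      unfolding in_column_space_iff
      by (rule exI[of _ "(?F $ j $ 2 * a - ?F $ i $ 2 * b) / ?D"],
          rule exI[of _ "(?F $ i $ 1 * b - ?F $ j $ 1 * a) / ?D"])
        (use D in \<open>auto simp: ab field_simps signed_minor_def\<close>)
  next
    fix x assume "x \<in> column_space ?F"
    then obtain a b where ab: "\<And>p. x $ p = ?F $ p $ 1 * a + ?F $ p $ 2 * b"
      by (auto simp: in_column_space_iff)
    have "x $ p * ?D = signed_minor ?F p j * (?F $ i $ 1 * a + ?F $ i $ 2 * b) + signed_minor ?F i p * (?F $ j $ 1 * a + ?F $ j $ 2 * b)" for p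
      by (simp add: ab signed_minor_def algebra_simps)
    then have "x $ p = (signed_minor ?F p j * (?F $ i $ 1 * a + ?F $ i $ 2 * b) + signed_minor ?F i p * (?F $ j $ 1 * a + ?F $ j $ 2 * b)) / ?D" for p
      using D by (simp only: eq_divide_eq if_True not_False_eq_True)
    then have "x $ p = signed_minor ?F p j / ?D * (?F $ i $ 1 * a + ?F $ i $ 2 * b) + signed_minor ?F i p / ?D * (?F $ j $ 1 * a + ?F $ j $ 2 * b)" for p
      by (simp add: add_divide_distrib)
    then show "x \<in> column_space ?A" by (auto simp: in_column_space_iff vector_2)
  qed
  moreover have "signed_minor ?F j j = 0" "signed_minor ?F i i = 0" by (simp_all add: signed_minor_def)
  ultimately show "column_space ?A = L \<and> ?A $ i = vector [1, 0] \<and> ?A $ j = vector [0, 1]"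
    using D main_stratum_frame(2)[OF L] by simp
next
  fix A A' :: "complex^2^5"
  assume A: "column_space A = L \<and> A $ i = vector [1, 0] \<and> A $ j = vector [0, 1]"
  show "A = (\<chi> p. vector [signed_minor (frame L) p j / signed_minor (frame L) i j, signed_minor (frame L) i p / signed_minor (frame L) i j])"
  proof -
    \<comment> \<open>With unit vectors as rows i and j, every entry of \<open>A\<close> is a minor
      involving one of these rows. The minors are fixed up to the factor \<open>d\<close>, and the
      minor of rows i and j, being 1, fixes \<open>d\<close>.\<close>
    obtain d where d: "\<And>p q. signed_minor A p q = d * signed_minor (frame L) p q"
      using signed_minor_column_space[of A "frame L"] A main_stratum_frame(2)[OF L] by auto
    have "signed_minor A i j = 1" using A by (simp add: signed_minor_def vector_2)
    then have "d * signed_minor (frame L) i j = 1" using d[of i j] by simp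
    then have "d = 1 / signed_minor (frame L) i j" by (metis mult_zero_right nonzero_eq_divide_eq zero_neq_one)
    moreover have "signed_minor A p j = A $ p $ 1" "signed_minor A i p = A $ p $ 2" for p using A by (simp_all add: signed_minor_def vector_2)
    ultimately show ?thesis using d by (simp add: vec_eq_iff forall_2 vector_2)
  qed
qed

lemma generic_of_column_space:
  assumes "column_space A \<in> main_stratum"
    and "signed_minor A i j \<noteq> 0"
  shows "generic A"
proof -
  obtain d where d: "\<And>p q. signed_minor A p q = d * signed_minor (frame (column_space A)) p q"
    using signed_minor_column_space[of A "frame (column_space A)"] main_stratum_frame(2)[OF assms(1)] by auto
  then have "d \<noteq> 0" using assms(2) by auto
  then show ?thesis using main_stratum_frame(1)[OF assms(1)] d by (simp add: generic_def)
qed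

lemma chart_matrix_generic: "L \<in> main_stratum \<Longrightarrow> i \<noteq> j \<Longrightarrow> generic (chart_matrix i j L)"
  using chart_matrix[of L i j] by (intro generic_of_column_space[of _ i j]) (auto simp: signed_minor_def vector_2)

definition rest :: "5 \<Rightarrow> 5 \<Rightarrow> 5 \<Rightarrow> 5 \<Rightarrow> 5 \<Rightarrow> bool" where
  "rest i j k1 k2 k3 \<longleftrightarrow> sorted_list_of_set (UNIV - {i, j}) = [k1, k2, k3]"

lemma rest_exists:
  assumes "i \<noteq> j"
  obtains k1 k2 k3 where "rest i j k1 k2 k3"
proof -
  have "card (UNIV - {i, j} :: 5 set) = 3"
    using assms by (simp add: card_Diff_subset)
  then have "length (sorted_list_of_set (UNIV - {i, j} :: 5 set)) = Suc (Suc (Suc 0))"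
    by (simp only: length_sorted_list_of_set numeral_3_eq_3)
  then obtain k1 k2 k3 where "sorted_list_of_set (UNIV - {i, j}) = [k1, k2, k3]"
    unfolding length_Suc_conv length_0_conv by blast
  then show thesis using that by (simp only: rest_def)
qed

lemma rest_distinct:
  assumes "rest i j k1 k2 k3"
  shows "k1 \<noteq> k2" "k1 \<noteq> k3" "k2 \<noteq> k3" "k1 \<noteq> i" "k1 \<noteq> j" "k2 \<noteq> i" "k2 \<noteq> j" "k3 \<noteq> i" "k3 \<noteq> j"
    "UNIV = {i, j, k1, k2, k3}"
proof -
  have "set [k1, k2, k3] = UNIV - {i, j}" and "distinct [k1, k2, k3]"
    unfolding assms[unfolded rest_def, symmetric] by simp_all
  then have *: "{k1, k2, k3} = UNIV - {i, j}" and "distinct [k1, k2, k3]" by simp_all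
  then show "k1 \<noteq> k2" "k1 \<noteq> k3" "k2 \<noteq> k3" by auto
  show "k1 \<noteq> i" "k1 \<noteq> j" "k2 \<noteq> i" "k2 \<noteq> j" "k3 \<noteq> i" "k3 \<noteq> j" "UNIV = {i, j, k1, k2, k3}"
    using * by blast+
qed

text \<open>In the normalized matrix the entries of row p are the minor of (p, j) and minus the
  minor of (p, i). Hence (z1 z5 : z2 z4) and its analogues are cross-ratios with j and i as last
  arguments; the two minus signs form a common factor.\<close>

lemma chart_coords_eq:
  assumes L: "L \<in> main_stratum" and ij: "i \<noteq> j" and k: "rest i j k1 k2 k3"
  shows "chart_coords i j L = (cross_ratio k1 k2 j i L, cross_ratio k1 k3 j i L, cross_ratio k2 k3 j i L)"
proof -
  let ?A = "chart_matrix i j L"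
  have A: "column_space ?A = L" "?A $ i = vector [1, 0]" "?A $ j = vector [0, 1]"
    using chart_matrix[OF L ij] by auto
  have signed_minor: "signed_minor ?A p j = ?A $ p $ 1" "signed_minor ?A p i = - ?A $ p $ 2" for p
    using A by (simp_all add: signed_minor_def vector_2)
  have "cross_ratio p q j i L = hom2 (?A $ p $ 1 * ?A $ q $ 2) (?A $ q $ 1 * ?A $ p $ 2)" for p q
    using cross_ratio_conv_hom2[OF chart_matrix_generic[OF L ij], of p q j i]
      hom2_scale[of "-1" "?A $ p $ 1 * ?A $ q $ 2" "?A $ q $ 1 * ?A $ p $ 2"]
    by (simp add: A signed_minor mult.commute)
  then show ?thesis using k by (simp add: chart_coords_def rest_def Let_def)
qed

definition chart_lift :: "complex^2^5 \<Rightarrow> 5 \<Rightarrow> 5 \<Rightarrow> 5 \<Rightarrow> 5 \<Rightarrow> 5 \<Rightarrow> (complex^2) \<times> (complex^2) \<times> (complex^2)" where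
  "chart_lift A i j k1 k2 k3 = (cr_vec A k1 k2 j i, cr_vec A k1 k3 j i, cr_vec A k2 k3 j i)"

lemma chart_coords_lift:
  assumes "L \<in> main_stratum" "i \<noteq> j" "rest i j k1 k2 k3"
  shows "chart_coords i j L = lines (chart_lift (frame L) i j k1 k2 k3)"
  using chart_coords_eq[OF assms] by (simp add: lines_def chart_lift_def cross_ratio_def)

text \<open>A rearrangement of the Pluecker relation. For a generic matrix and distinct rows it
  shows that the cross-ratio differs from (1:1).\<close>

lemma cr_vec_off_diagonal:
  "cr_vec A p q r s $ 1 - cr_vec A p q r s $ 2 = signed_minor A p q * signed_minor A r s"
  "cr_vec A p q r s $ 2 - cr_vec A p q r s $ 1 = - (signed_minor A p q * signed_minor A r s)"
  using signed_minor_pluecker[of A p r q s] by simp_all (simp add: algebra_simps)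

text \<open>Both sides of the surface equation are the same product of six minors, and the first
  coordinate is not (1:1), so the point is not the center.\<close>

lemma lift_in_cover:
  assumes A: "generic A" and "i \<noteq> j" and k: "rest i j k1 k2 k3"
  shows "chart_lift A i j k1 k2 k3 \<in> surface_cover"
proof -
  have "cr_vec A p q j i \<noteq> 0" if "p \<noteq> i" "p \<noteq> j" "q \<noteq> i" "q \<noteq> j" for p q
    using genericD[OF A] that by (auto simp: vec2_eq_0_iff)
  moreover have "cr_vec A k1 k2 j i $ 1 \<noteq> cr_vec A k1 k2 j i $ 2"
    using cr_vec_off_diagonal(1)[of A k1 k2 j i] genericD[OF A, of k1 k2] genericD[OF A, of j i]
      rest_distinct[OF k] assms(2) by auto
  ultimately show ?thesis using rest_distinct[OF k] by (simp add: chart_lift_def surface_cover_def)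
qed

text \<open>The differences in \<open>ratio\<close> are products of two minors by the Pluecker
  relation. The common factor, the minor of (j, i) times that of (k3, j), cancels and leaves a
  cross-ratio without j; for the inverted coordinates (k3, i) takes the place of (k3, j) and i
  disappears.\<close>

lemma cross_ratios_lift:
  assumes L: "L \<in> main_stratum" and ij: "i \<noteq> j" and k: "rest i j k1 k2 k3"
  shows "cross_ratios (chart_lift (frame L) i j k1 k2 k3) =
     (cross_ratio k1 k2 j i L, cross_ratio k1 k3 j i L, cross_ratio k2 k3 j i L, cross_ratio k1 k2 k3 j L, cross_ratio k1 k2 k3 i L)"
proof -
  let ?A = "frame L"
  let ?u = "cr_vec ?A k1 k2 j i" and ?v = "cr_vec ?A k1 k3 j i" and ?w = "cr_vec ?A k2 k3 j i"
  have nz: "signed_minor ?A p q \<noteq> 0" if "p \<noteq> q" for p q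
    using genericD[OF main_stratum_frame(1)[OF L] that] .
  note d = rest_distinct(1-9)[OF k] rest_distinct(1-9)[OF k, symmetric] ij ij[symmetric]
  have "ratio ?u ?v ?w = hom2 ((signed_minor ?A k1 k3 * signed_minor ?A j i) * (signed_minor ?A k2 i * signed_minor ?A k3 j))
      ((signed_minor ?A k2 k3 * signed_minor ?A j i) * (signed_minor ?A k1 i * signed_minor ?A k3 j))"
    using nz d unfolding ratio_def cr_vec_off_diagonal by simp
  also have "\<dots> = hom2 (signed_minor ?A k1 k3 * signed_minor ?A k2 i) (signed_minor ?A k1 i * signed_minor ?A k2 k3)"
    using nz d hom2_scale[of "signed_minor ?A j i * signed_minor ?A k3 j" "signed_minor ?A k1 k3 * signed_minor ?A k2 i" "signed_minor ?A k1 i * signed_minor ?A k2 k3"]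
    by (simp add: mult_ac)
  finally have 5: "ratio ?u ?v ?w = cross_ratio k1 k2 k3 i L" by (simp add: cross_ratio_def line_conv_hom2)
  have "ratio (flip ?u) (flip ?v) (flip ?w) = hom2 ((- (signed_minor ?A k1 k3 * signed_minor ?A j i)) * (signed_minor ?A k2 j * signed_minor ?A k3 i))
      ((- (signed_minor ?A k2 k3 * signed_minor ?A j i)) * (signed_minor ?A k1 j * signed_minor ?A k3 i))"
    using nz d unfolding ratio_def flip_nth cr_vec_off_diagonal by simp
  also have "\<dots> = hom2 (signed_minor ?A k1 k3 * signed_minor ?A k2 j) (signed_minor ?A k1 j * signed_minor ?A k2 k3)"
    using nz d hom2_scale[of "- (signed_minor ?A j i * signed_minor ?A k3 i)" "signed_minor ?A k1 k3 * signed_minor ?A k2 j" "signed_minor ?A k1 j * signed_minor ?A k2 k3"]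
    by (simp add: mult_ac)
  finally have 4: "ratio (flip ?u) (flip ?v) (flip ?w) = cross_ratio k1 k2 k3 j L" by (simp add: cross_ratio_def line_conv_hom2)
  show ?thesis using 4 5 by (simp add: cross_ratios_def chart_lift_def cross_ratio_def)
qed

section \<open>The torus action and the coordinates on F\<close>

definition scale_rows :: "complex^5 \<Rightarrow> complex^2^5 \<Rightarrow> complex^2^5" where
  "scale_rows t A = (\<chi> p. t $ p *s A $ p)"

lemma act_column_space: "act t (column_space A) = column_space (scale_rows t A)"
proof -
  have "(\<chi> i. t $ i * (A *v v) $ i) = scale_rows t A *v v" for v
    by (simp add: vec_eq_iff matrix_vector_mult_2 scale_rows_def algebra_simps)
  then show ?thesis by (simp add: act_def column_space_def image_image)
qed

lemma signed_minor_scale_rows: "signed_minor (scale_rows t A) p q = t $ p * t $ q * signed_minor A p q"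
  by (simp add: signed_minor_def scale_rows_def algebra_simps)

lemma generic_scale_rows: "t \<in> ctorus \<Longrightarrow> generic A \<Longrightarrow> generic (scale_rows t A)"
  by (simp add: generic_def signed_minor_scale_rows ctorus_def)

lemma act_main_stratum:
  assumes "L \<in> main_stratum" "t \<in> ctorus"
  shows "act t L \<in> main_stratum"
  using main_stratumI[OF generic_scale_rows[OF assms(2) main_stratum_frame(1)[OF assms(1)]]]
  by (simp add: act_column_space[symmetric] main_stratum_frame(2)[OF assms(1)])

text \<open>Each of the four rows occurs once in each of the two products, so both are multiplied by
  the same factor.\<close>

lemma cross_ratio_act:
  assumes L: "L \<in> main_stratum" and t: "t \<in> ctorus"
  shows "cross_ratio p q r s (act t L) = cross_ratio p q r s L"
proof -
  let ?A = "frame L"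
  note A = main_stratum_frame[OF L]
  have "cross_ratio p q r s (act t L) = line (cr_vec (scale_rows t ?A) p q r s)"
    using cross_ratio_column_space[OF generic_scale_rows[OF t A(1)]] by (simp add: act_column_space[symmetric] A(2))
  also have "cr_vec (scale_rows t ?A) p q r s = (t $ p * t $ q * t $ r * t $ s) *s cr_vec ?A p q r s"
    by (simp add: vec_eq_iff forall_2 signed_minor_scale_rows mult_ac)
  also have "line \<dots> = line (cr_vec ?A p q r s)"
    using t by (intro line_scale) (simp add: ctorus_def)
  finally show ?thesis by (simp add: cross_ratio_def)
qed

lemma chart_coords_act:
  assumes "L \<in> main_stratum" "t \<in> ctorus" "i \<noteq> j"
  shows "chart_coords i j (act t L) = chart_coords i j L"
proof -
  obtain k1 k2 k3 where "rest i j k1 k2 k3" using rest_exists[OF assms(3)] .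
  then show ?thesis using assms by (simp add: chart_coords_eq act_main_stratum cross_ratio_act)
qed

lemma act_act: "act s (act t L) = act (\<chi> i. s $ i * t $ i) L"
  by (simp add: act_def image_image mult.assoc)

lemma act_1: "act 1 L = L"
  by (simp add: act_def)

lemma orbit_act:
  assumes t: "t \<in> ctorus"
  shows "orbit ctorus (act t L) = orbit ctorus L"
proof
  show "orbit ctorus (act t L) \<subseteq> orbit ctorus L"
    using t by (auto simp: orbit_def act_act ctorus_def intro!: imageI)
  show "orbit ctorus L \<subseteq> orbit ctorus (act t L)"
  proof
    fix M assume "M \<in> orbit ctorus L"
    then obtain s where s: "M = act s L" "s \<in> ctorus" by (auto simp: orbit_def)
    have "M = act (\<chi> i. s $ i / t $ i) (act t L)" "(\<chi> i. s $ i / t $ i) \<in> ctorus"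
      using s t by (auto simp: act_act ctorus_def)
    then show "M \<in> orbit ctorus (act t L)" by (auto simp: orbit_def)
  qed
qed

lemma self_in_orbit: "L \<in> orbit ctorus L"
  unfolding orbit_def by (rule image_eqI[of _ _ 1]) (simp_all add: act_1 ctorus_def)

text \<open>The plane chosen in \<open>F_coords\<close> depends only on the orbit \<open>y\<close>,
  so a single \<open>L\<close> serves for all charts simultaneously. This allows coordinates of the
  same point of F in two charts to be compared.\<close>

lemma F_main_representative:
  assumes "y \<in> F_main"
  shows "\<exists>L\<in>main_stratum. y = orbit ctorus L \<and> (\<forall>i j. F_coords i j y = chart_coords i j L)"
proof -
  obtain L0 where L0: "L0 \<in> main_stratum" "y = orbit ctorus L0" using assms by (auto simp: F_main_def)
  then have "L0 \<in> y" using self_in_orbit by simp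
  then have "(SOME L. L \<in> y) \<in> y" by (rule someI)
  then obtain t where t: "(SOME L. L \<in> y) = act t L0" "t \<in> ctorus" using L0 by (auto simp: orbit_def)
  show ?thesis
    by (rule bexI[of _ "act t L0"])
      (use t L0 act_main_stratum[OF L0(1) t(2)] orbit_act[OF t(2)] in \<open>simp_all add: F_coords_def\<close>)
qed

text \<open>Five points of CP^1 after a projective transformation that puts i, j, k3 at (1:0),
  (0:1), (1:1); the two remaining points are the parameters (a:1) and (b:1).\<close>

definition normal_form :: "5 \<Rightarrow> 5 \<Rightarrow> 5 \<Rightarrow> 5 \<Rightarrow> complex \<Rightarrow> complex \<Rightarrow> complex^2^5" where
  "normal_form i j k1 k2 a b = (\<chi> p. if p = i then vector [1, 0] else if p = j then vector [0, 1]
     else if p = k1 then vector [a, 1] else if p = k2 then vector [b, 1] else vector [1, 1])"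

lemma column_space_scale_column:
  assumes "c \<noteq> 0"
  shows "column_space (\<chi> p. vector [c * A $ p $ 1, A $ p $ 2]) = column_space A"
proof (intro set_eqI iffI)
  fix x assume "x \<in> column_space (\<chi> p. vector [c * A $ p $ 1, A $ p $ 2])"
  then obtain a b where "\<And>p. x $ p = c * A $ p $ 1 * a + A $ p $ 2 * b"
    by (auto simp: in_column_space_iff vector_2)
  then have "\<forall>p. x $ p = A $ p $ 1 * (c * a) + A $ p $ 2 * b" by (simp add: mult_ac)
  then show "x \<in> column_space A" unfolding in_column_space_iff by blast
next
  fix x assume "x \<in> column_space A"
  then obtain a b where "\<And>p. x $ p = A $ p $ 1 * a + A $ p $ 2 * b" by (auto simp: in_column_space_iff)
  then show "x \<in> column_space (\<chi> p. vector [c * A $ p $ 1, A $ p $ 2])"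
    unfolding in_column_space_iff
    by (intro exI[of _ "a / c"] exI[of _ b]) (use assms in \<open>simp add: vector_2\<close>)
qed

lemma normal_form_exists:
  assumes L: "L \<in> main_stratum" and ij: "i \<noteq> j" and k: "rest i j k1 k2 k3"
  obtains a b where "orbit ctorus L = orbit ctorus (column_space (normal_form i j k1 k2 a b))"
    "cross_ratio k1 k3 j i L = hom2 a 1" "cross_ratio k2 k3 j i L = hom2 b 1"
proof -
  let ?A = "chart_matrix i j L"
  have A: "column_space ?A = L" "?A $ i = vector [1, 0]" "?A $ j = vector [0, 1]"
    using chart_matrix[OF L ij] by auto
  have signed_minor: "signed_minor ?A p j = ?A $ p $ 1" "signed_minor ?A p i = - ?A $ p $ 2" for p
    using A by (simp_all add: signed_minor_def vector_2)
  have nz: "?A $ p $ 1 \<noteq> 0" "?A $ p $ 2 \<noteq> 0" if "p \<noteq> i" "p \<noteq> j" for p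
    using genericD[OF chart_matrix_generic[OF L ij] that(1)] genericD[OF chart_matrix_generic[OF L ij] that(2)]
    by (simp_all add: signed_minor)
  note d = rest_distinct[OF k]
  \<comment> \<open>The torus element \<open>t\<close> makes the second entry of each row other than
    i equal to 1. Multiplying the first column by \<open>c\<close> then turns row k3 into (1, 1),
    and the entry 1/c of \<open>t\<close> keeps row i equal to (1, 0).\<close>
  define c where "c = ?A $ k3 $ 2 / ?A $ k3 $ 1"
  define t :: "complex^5" where "t = (\<chi> p. if p = i then 1 / c else if p = j then 1 else 1 / ?A $ p $ 2)"
  define a where "a = c * ?A $ k1 $ 1 / ?A $ k1 $ 2"
  define b where "b = c * ?A $ k2 $ 1 / ?A $ k2 $ 2"
  have c: "c \<noteq> 0" using nz[of k3] d by (simp add: c_def)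
  have t: "t \<in> ctorus" using c nz ij by (auto simp: ctorus_def t_def)
  have "normal_form i j k1 k2 a b $ p = (\<chi> p. vector [c * scale_rows t ?A $ p $ 1, scale_rows t ?A $ p $ 2]) $ p"
    if "p = i \<or> p = j \<or> p = k1 \<or> p = k2 \<or> p = k3" for p
    using that d ij c nz[of k1] nz[of k2] nz[of k3]
    by (auto simp: normal_form_def scale_rows_def t_def a_def b_def A vector_2 vec_eq_iff forall_2 c_def)
  then have "normal_form i j k1 k2 a b = (\<chi> p. vector [c * scale_rows t ?A $ p $ 1, scale_rows t ?A $ p $ 2])"
    using d(10) by (subst vec_eq_iff) blast
  then have "column_space (normal_form i j k1 k2 a b) = act t L"
    using column_space_scale_column[OF c] act_column_space[of t ?A] A(1) by simp
  then have "orbit ctorus L = orbit ctorus (column_space (normal_form i j k1 k2 a b))"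
    using orbit_act[OF t] by simp
  moreover have "cross_ratio p k3 j i L = hom2 (c * ?A $ p $ 1 / ?A $ p $ 2) 1" if "p \<noteq> i" "p \<noteq> j" for p
    using cross_ratio_conv_hom2[OF chart_matrix_generic[OF L ij], of p k3 j i] nz[OF that] nz[of k3] d
    by (auto simp: A signed_minor c_def hom2_eq_iff)
  ultimately show thesis using that[of a b] d by (simp add: a_def b_def)
qed

text \<open>The second and third coordinates are (a:1) and (b:1), where a and b are the parameters
  of a normal form in the orbit, so they determine the orbit.\<close>

lemma F_coords_inj:
  assumes "i \<noteq> j"
  shows "inj_on (F_coords i j) F_main"
proof (rule inj_onI)
  fix y y' assume "y \<in> F_main" "y' \<in> F_main" and eq: "F_coords i j y = F_coords i j y'"
  obtain k1 k2 k3 where k: "rest i j k1 k2 k3" using rest_exists[OF assms] .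
  obtain L where L: "L \<in> main_stratum" "y = orbit ctorus L" "F_coords i j y = chart_coords i j L"
    using F_main_representative[OF \<open>y \<in> F_main\<close>] by blast
  obtain L' where L': "L' \<in> main_stratum" "y' = orbit ctorus L'" "F_coords i j y' = chart_coords i j L'"
    using F_main_representative[OF \<open>y' \<in> F_main\<close>] by blast
  obtain a b where ab: "orbit ctorus L = orbit ctorus (column_space (normal_form i j k1 k2 a b))"
    "cross_ratio k1 k3 j i L = hom2 a 1" "cross_ratio k2 k3 j i L = hom2 b 1"
    using normal_form_exists[OF L(1) assms k] .
  obtain a' b' where ab': "orbit ctorus L' = orbit ctorus (column_space (normal_form i j k1 k2 a' b'))"
    "cross_ratio k1 k3 j i L' = hom2 a' 1" "cross_ratio k2 k3 j i L' = hom2 b' 1"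
    using normal_form_exists[OF L'(1) assms k] .
  have "hom2 a 1 = hom2 a' 1" "hom2 b 1 = hom2 b' 1"
    using eq L(3) L'(3) ab(2,3) ab'(2,3) by (simp_all add: chart_coords_eq[OF _ assms k] L(1) L'(1))
  then have "a = a'" "b = b'" by (simp_all add: hom2_eq_iff)
  then show "y = y'" using L(2) L'(2) ab(1) ab'(1) by simp
qed

lemma chart_coords_in_F_chart:
  assumes L: "L \<in> main_stratum" and ij: "i \<noteq> j"
  shows "chart_coords i j L \<in> F_chart i j"
proof -
  obtain k1 k2 k3 where k: "rest i j k1 k2 k3" using rest_exists[OF ij] .
  let ?A = "frame L"
  have nz: "signed_minor ?A p q \<noteq> 0" if "p \<noteq> q" for p q
    using genericD[OF main_stratum_frame(1)[OF L] that] .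
  have *: "cr_vec ?A p q j i $ 1 \<noteq> 0 \<and> cr_vec ?A p q j i $ 2 \<noteq> 0 \<and> cr_vec ?A p q j i $ 1 \<noteq> cr_vec ?A p q j i $ 2"
    if "p \<noteq> q" "p \<noteq> i" "p \<noteq> j" "q \<noteq> i" "q \<noteq> j" for p q
    using cr_vec_off_diagonal(1)[of ?A p q j i] that nz ij by auto
  have "chart_coords i j L = (hom2 (cr_vec ?A k1 k2 j i $ 1) (cr_vec ?A k1 k2 j i $ 2),
     hom2 (cr_vec ?A k1 k3 j i $ 1) (cr_vec ?A k1 k3 j i $ 2),
     hom2 (cr_vec ?A k2 k3 j i $ 1) (cr_vec ?A k2 k3 j i $ 2))"
    unfolding chart_coords_eq[OF L ij k] cross_ratio_def line_conv_hom2 ..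
  moreover have "cr_vec ?A k1 k2 j i $ 1 * cr_vec ?A k1 k3 j i $ 2 * cr_vec ?A k2 k3 j i $ 1
     = cr_vec ?A k1 k2 j i $ 2 * cr_vec ?A k1 k3 j i $ 1 * cr_vec ?A k2 k3 j i $ 2"
    by simp
  ultimately show ?thesis
    unfolding F_chart_def using * rest_distinct[OF k] by blast
qed

lemma F_chart_subset:
  assumes ij: "i \<noteq> j"
  shows "F_chart i j \<subseteq> F_coords i j ` F_main"
proof
  fix c assume "c \<in> F_chart i j"
  then obtain c1 c1' c2 c2' c3 c3' where c: "c = (hom2 c1 c1', hom2 c2 c2', hom2 c3 c3')"
     "c1 * c2' * c3 = c1' * c2 * c3'" "c1 \<noteq> 0" "c1' \<noteq> 0" "c1 \<noteq> c1'"
     "c2 \<noteq> 0" "c2' \<noteq> 0" "c2 \<noteq> c2'" "c3 \<noteq> 0" "c3' \<noteq> 0" "c3 \<noteq> c3'"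
    unfolding F_chart_def by blast
  obtain k1 k2 k3 where k: "rest i j k1 k2 k3" using rest_exists[OF ij] .
  note d = rest_distinct(1-9)[OF k] rest_distinct(1-9)[OF k, symmetric] ij ij[symmetric]
  \<comment> \<open>The second and third coordinates prescribe the parameters of the normal form.
    The surface equation then makes the first coordinate (a:b), and the conditions on c say that the
    five points are distinct.\<close>
  define a where "a = c2 / c2'"
  define b where "b = c3 / c3'"
  let ?N = "normal_form i j k1 k2 a b"
  have ab: "a \<noteq> 0" "a \<noteq> 1" "b \<noteq> 0" "b \<noteq> 1" and c1: "c1 * b = c1' * a"
    using c by (auto simp: a_def b_def field_simps)
  then have "a \<noteq> b" using c(5) by auto
  have rows: "?N $ i = vector [1, 0]" "?N $ j = vector [0, 1]" "?N $ k1 = vector [a, 1]"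
    "?N $ k2 = vector [b, 1]" "?N $ k3 = vector [1, 1]"
    using d by (simp_all add: normal_form_def)
  have "signed_minor ?N p q \<noteq> 0" if "p \<noteq> q" for p q
  proof -
    have "p \<in> {i, j, k1, k2, k3}" "q \<in> {i, j, k1, k2, k3}" using rest_distinct(10)[OF k] by blast+
    then show ?thesis
      using that ab \<open>a \<noteq> b\<close> by (auto simp: signed_minor_def rows vector_2)
  qed
  then have gen: "generic ?N" by (simp add: generic_def)
  define L where "L = column_space ?N"
  have L: "L \<in> main_stratum" unfolding L_def by (rule main_stratumI[OF gen])
  have "chart_coords i j L = (hom2 (- a) (- b), hom2 (- a) (- 1), hom2 (- b) (- 1))"
    unfolding chart_coords_eq[OF L ij k] unfolding L_def cross_ratio_conv_hom2[OF gen]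
    by (simp add: signed_minor_def rows vector_2)
  also have "\<dots> = c"
  proof -
    have "hom2 (- a) (- b) = hom2 c1 c1'"
      using c(3) ab c1 by (intro hom2_eqI) (auto simp: mult.commute)
    moreover have "hom2 (- a) (- 1) = hom2 c2 c2'" "hom2 (- b) (- 1) = hom2 c3 c3'"
      using c by (auto simp: hom2_eq_iff a_def b_def)
    ultimately show ?thesis using c(1) by simp
  qed
  finally have cL: "chart_coords i j L = c" .
  have y: "orbit ctorus L \<in> F_main" using L by (simp add: F_main_def)
  \<comment> \<open>\<open>F_coords\<close> evaluates at some chosen plane of the orbit, not
    necessarily at \<open>L\<close>; invariance under the torus bridges the gap.\<close>
  moreover have "F_coords i j (orbit ctorus L) = c"
  proof -
    obtain L' where L': "orbit ctorus L = orbit ctorus L'" "F_coords i j (orbit ctorus L) = chart_coords i j L'"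
      using F_main_representative[OF y] by blast
    have "L' \<in> orbit ctorus L" using self_in_orbit[of L'] L'(1) by simp
    then obtain t where "L' = act t L" "t \<in> ctorus" by (auto simp: orbit_def)
    then show ?thesis using L'(2) cL chart_coords_act[OF L _ ij] by simp
  qed
  ultimately show "c \<in> F_coords i j ` F_main" by blast
qed

section \<open>Change of charts\<close>

lemma proj_space_map_exists:
  fixes f :: "complex^2 \<Rightarrow> complex^2"
  assumes "continuous_on UNIV f" and scale: "\<And>c v. f (c *s v) = c *s f v" and nz: "\<And>v. v \<noteq> 0 \<Longrightarrow> f v \<noteq> 0"
  obtains g where "continuous_map proj_space proj_space g" "\<And>v. v \<noteq> 0 \<Longrightarrow> g (line v) = line (f v)"
proof -
  have qm: "quotient_map (top_of_set (UNIV - {0 :: complex^2})) proj_space line"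
    by (simp add: proj_space_def quotient_map_quotient_topology)
  have "continuous_map (top_of_set (UNIV - {0})) (top_of_set (UNIV - {0})) f"
    using nz continuous_on_subset[OF assms(1)] by auto
  then have "continuous_map (top_of_set (UNIV - {0})) proj_space (\<lambda>v. line (f v))"
    by (rule continuous_map_compose[OF _ continuous_map_line, unfolded o_def])
  then show thesis
  proof (rule quotient_map_lift_exists[OF qm])
    fix v w assume "v \<in> topspace (top_of_set (UNIV - {0 :: complex^2}))" "line v = line w"
    then obtain c where "c \<noteq> 0" "v = c *s w" using line_eqE[of v w] by auto
    then show "line (f v) = line (f w)" by (simp add: scale line_scale)
  qed (use that in auto)
qed

definition cross_ratio_extends :: "5 \<Rightarrow> 5 \<Rightarrow> 5 \<Rightarrow> 5 \<Rightarrow> 5 \<Rightarrow> 5 \<Rightarrow> bool" where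
  "cross_ratio_extends i j p q r s \<longleftrightarrow> (\<exists>g. continuous_map blowup proj_space g \<and>
     (\<forall>L\<in>main_stratum. g (Inl (chart_coords i j L)) = cross_ratio p q r s L))"

text \<open>A linear map that realizes the reordering on \<open>cr_vec\<close> induces a continuous
  map of CP^1, which is composed with the known extension.\<close>

lemma cross_ratio_extends_linear:
  fixes f :: "complex^2 \<Rightarrow> complex^2"
  assumes "cross_ratio_extends i j p q r s" and "distinct [p, q, r, s]"
    and "continuous_on UNIV f" "\<And>c v. f (c *s v) = c *s f v" "\<And>v. v \<noteq> 0 \<Longrightarrow> f v \<noteq> 0"
    and f: "\<And>A. f (cr_vec A p q r s) = cr_vec A p' q' r' s'"
  shows "cross_ratio_extends i j p' q' r' s'"
proof -
  obtain h where h: "continuous_map proj_space proj_space h" "\<And>v. v \<noteq> 0 \<Longrightarrow> h (line v) = line (f v)"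
    by (rule proj_space_map_exists[OF assms(3-5)]) (assumption | rule that)+
  obtain g where g: "continuous_map blowup proj_space g"
    "\<And>L. L \<in> main_stratum \<Longrightarrow> g (Inl (chart_coords i j L)) = cross_ratio p q r s L"
    using assms(1) by (auto simp: cross_ratio_extends_def)
  have "(h \<circ> g) (Inl (chart_coords i j L)) = cross_ratio p' q' r' s' L" if L: "L \<in> main_stratum" for L
  proof -
    have "cr_vec (frame L) p q r s \<noteq> 0"
      using genericD[OF main_stratum_frame(1)[OF L]] assms(2) by (simp add: vec2_eq_0_iff)
    then show ?thesis using g(2)[OF L] h(2) f by (simp add: cross_ratio_def)
  qed
  then show ?thesis
    using continuous_map_compose[OF g(1) h(1)] unfolding cross_ratio_extends_def by blast
qed

lemma cross_ratio_extends_swap_12: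
  assumes "cross_ratio_extends i j p q r s" "distinct [p, q, r, s]"
  shows "cross_ratio_extends i j q p r s"
  by (rule cross_ratio_extends_linear[OF assms, where f = flip])
    (auto simp: flip_scale vec_eq_iff forall_2 intro!: continuous_on_flip continuous_on_id)

lemma cross_ratio_extends_swap_34:
  assumes "cross_ratio_extends i j p q r s" "distinct [p, q, r, s]"
  shows "cross_ratio_extends i j p q s r"
  by (rule cross_ratio_extends_linear[OF assms, where f = flip])
    (auto simp: flip_scale vec_eq_iff forall_2 intro!: continuous_on_flip continuous_on_id)

text \<open>Exchanging the two middle points replaces a cross-ratio x by 1 - x, again by the
  Pluecker relation. Exchanging the first or the last two replaces it by 1/x.\<close>

lemma cross_ratio_extends_swap_23:
  assumes "cross_ratio_extends i j p q r s" "distinct [p, q, r, s]"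
  shows "cross_ratio_extends i j p r q s"
proof (rule cross_ratio_extends_linear[OF assms, where f = "\<lambda>v. vector [v $ 1 - v $ 2, - v $ 2]"])
  show "vector [cr_vec A p q r s $ 1 - cr_vec A p q r s $ 2, - cr_vec A p q r s $ 2] = cr_vec A p r q s" for A
    unfolding cr_vec_off_diagonal
    by (simp add: vec_eq_iff forall_2 vector_2 signed_minor_swap[of A q r])
  show "continuous_on UNIV (\<lambda>v. vector [v $ 1 - v $ 2, - v $ 2] :: complex^2)"
    by (intro continuous_on_vector_2 continuous_intros)
qed (auto simp: vec_eq_iff forall_2 vector_2 algebra_simps)

text \<open>The three adjacent transpositions generate all permutations of four points:
  \<open>p'\<close> is moved to the front, after which the six orders of the other three points are
  reached by the last two transpositions.\<close>

lemma cross_ratio_extends_permute: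
  assumes "cross_ratio_extends i j p q r s" "distinct [p, q, r, s]"
    and "{p', q', r', s'} = {p, q, r, s}" "distinct [p', q', r', s']"
  shows "cross_ratio_extends i j p' q' r' s'"
proof -
  define P where "P p q r s \<longleftrightarrow> cross_ratio_extends i j p q r s \<and> distinct [p, q, r, s]" for p q r s
  have 1: "P p q r s \<Longrightarrow> P q p r s" and 2: "P p q r s \<Longrightarrow> P p r q s" and 3: "P p q r s \<Longrightarrow> P p q s r"
    for p q r s
    using cross_ratio_extends_swap_12[of i j p q r s] cross_ratio_extends_swap_23[of i j p q r s] cross_ratio_extends_swap_34[of i j p q r s]
    by (auto simp: P_def)
  have P: "P p q r s" using assms by (simp add: P_def)
  have "\<exists>y z w. P p' y z w \<and> {p', y, z, w} = {p, q, r, s}"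
  proof -
    have *: "P q p r s" "P r p q s" "P s p q r"
      using 1[OF P] 1[OF 2[OF P]] 1[OF 2[OF 3[OF P]]] by simp_all
    have "p' \<in> {p, q, r, s}" using assms(3) by blast
    then consider "p' = p" | "p' = q" | "p' = r" | "p' = s" by blast
    then show ?thesis
    proof cases
      case 1
      show ?thesis by (rule exI[of _ q], rule exI[of _ r], rule exI[of _ s]) (use P 1 in simp)
    next
      case 2
      show ?thesis by (rule exI[of _ p], rule exI[of _ r], rule exI[of _ s]) (use * 2 in auto)
    next
      case 3
      show ?thesis by (rule exI[of _ p], rule exI[of _ q], rule exI[of _ s]) (use * 3 in auto)
    next
      case 4
      show ?thesis by (rule exI[of _ p], rule exI[of _ q], rule exI[of _ r]) (use * 4 in auto)
    qed
  qed
  then obtain y z w where P': "P p' y z w" and eq: "{p', y, z, w} = {p', q', r', s'}" using assms(3) by metis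
  have d: "distinct [p', y, z, w]" using P' by (simp add: P_def)
  have "P p' y z w" "P p' y w z" "P p' z y w" "P p' z w y" "P p' w y z" "P p' w z y"
    using P' 3[OF P'] 2[OF P'] 3[OF 2[OF P']] 2[OF 3[OF P']] 3[OF 2[OF 3[OF P']]] by simp_all
  moreover have "q' \<in> {y, z, w}" "r' \<in> {y, z, w}" "s' \<in> {y, z, w}"
    using eq d assms(4) by auto
  ultimately have "P p' q' r' s'" using assms(4) by auto
  then show ?thesis by (simp add: P_def)
qed

lemma chart_coords_cover:
  assumes "L \<in> main_stratum" "i \<noteq> j"
  obtains x where "x \<in> surface_cover" "chart_coords i j L = lines x"
proof -
  obtain k1 k2 k3 where k: "rest i j k1 k2 k3" using rest_exists[OF assms(2)] .
  show thesis
    using that[OF lift_in_cover[OF main_stratum_frame(1)[OF assms(1)] assms(2) k] chart_coords_lift[OF assms k]] .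
qed

lemma cross_ratio_extends_all:
  assumes ij: "i \<noteq> j" and d: "distinct [p, q, r, s]"
  shows "cross_ratio_extends i j p q r s"
proof -
  obtain \<Psi> where \<Psi>: "continuous_map blowup cp1_fifth \<Psi>"
    "\<And>x. x \<in> surface_cover \<Longrightarrow> \<Psi> (Inl (lines x)) = cross_ratios x"
    by (rule blowup_embedding) (assumption | rule that)+
  obtain k1 k2 k3 where k: "rest i j k1 k2 k3" using rest_exists[OF ij] .
  have \<Psi>L: "\<Psi> (Inl (chart_coords i j L)) = (cross_ratio k1 k2 j i L, cross_ratio k1 k3 j i L, cross_ratio k2 k3 j i L, cross_ratio k1 k2 k3 j L, cross_ratio k1 k2 k3 i L)"
    if L: "L \<in> main_stratum" for L
    using \<Psi>(2)[OF lift_in_cover[OF main_stratum_frame(1)[OF L] ij k]]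
    unfolding chart_coords_lift[OF L ij k] cross_ratios_lift[OF L ij k] .
  have c: "continuous_map blowup proj_space (\<lambda>x. fst (\<Psi> x))"
    "continuous_map blowup proj_space (\<lambda>x. fst (snd (\<Psi> x)))"
    "continuous_map blowup proj_space (\<lambda>x. fst (snd (snd (\<Psi> x))))"
    "continuous_map blowup proj_space (\<lambda>x. fst (snd (snd (snd (\<Psi> x)))))"
    "continuous_map blowup proj_space (\<lambda>x. snd (snd (snd (snd (\<Psi> x)))))"
    using \<Psi>(1) by (simp_all add: continuous_map_pairwise o_def)
  have extendsI: "cross_ratio_extends i j p q r s"
    if "continuous_map blowup proj_space g"
      and "\<And>L. L \<in> main_stratum \<Longrightarrow> g (Inl (chart_coords i j L)) = cross_ratio p q r s L" for g p q r s
    using that by (auto simp: cross_ratio_extends_def)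
  have e: "cross_ratio_extends i j k1 k2 j i" "cross_ratio_extends i j k1 k3 j i" "cross_ratio_extends i j k2 k3 j i"
    "cross_ratio_extends i j k1 k2 k3 j" "cross_ratio_extends i j k1 k2 k3 i"
    using extendsI[OF c(1)] extendsI[OF c(2)] extendsI[OF c(3)] extendsI[OF c(4)] extendsI[OF c(5)]
    by (simp_all add: \<Psi>L)
  note k' = rest_distinct[OF k]
  \<comment> \<open>Four distinct indices omit exactly one index \<open>m\<close>, and exactly one
    of the five components of \<Psi> is a cross-ratio of the same four points.\<close>
  have "card {p, q, r, s} = 4" using d by simp
  then have "{p, q, r, s} \<noteq> UNIV" by auto
  then obtain m where m: "m \<notin> {p, q, r, s}" by blast
  have pqrs: "{p, q, r, s} = UNIV - {m}"
    by (rule card_subset_eq) (use m \<open>card {p, q, r, s} = 4\<close> in \<open>auto simp: card_Diff_subset\<close>)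
  have *: "cross_ratio_extends i j p q r s"
    if "cross_ratio_extends i j a b c d" "distinct [a, b, c, d]" "UNIV - {m} = {a, b, c, d}" for a b c d
    using cross_ratio_extends_permute[OF that(1,2)] that(3) pqrs d by simp
  have "m \<in> {i, j, k1, k2, k3}" using k'(10) by blast
  then consider "m = i" | "m = j" | "m = k1" | "m = k2" | "m = k3" by blast
  then show ?thesis
  proof cases
    case 1
    show ?thesis by (rule *[OF e(4)]) (use k' ij 1 in auto)
  next
    case 2
    show ?thesis by (rule *[OF e(5)]) (use k' ij 2 in auto)
  next
    case 3
    show ?thesis by (rule *[OF e(3)]) (use k' ij 3 in auto)
  next
    case 4
    show ?thesis by (rule *[OF e(2)]) (use k' ij 4 in auto)
  next
    case 5
    show ?thesis by (rule *[OF e(1)]) (use k' ij 5 in auto)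
  qed
qed

text \<open>Following the transition map by \<Psi> gives the five cross-ratios that belong to the
  chart \<open>k\<close>, \<open>l\<close>. Each of them extends over the blowup in which the
  coordinates of the chart \<open>i\<close>, \<open>j\<close> are taken.\<close>

lemma transition_map_extends:
  assumes ij: "i \<noteq> j" and kl: "k \<noteq> l"
    and \<Psi>: "\<And>x. x \<in> surface_cover \<Longrightarrow> \<Psi> (Inl (lines x)) = cross_ratios x"
  obtains G where "continuous_map blowup cp1_fifth G"
    "\<And>L. L \<in> main_stratum \<Longrightarrow> G (Inl (chart_coords i j L)) = \<Psi> (Inl (chart_coords k l L))"
proof -
  obtain m1 m2 m3 where m: "rest k l m1 m2 m3" using rest_exists[OF kl] .
  have e: "cross_ratio_extends i j m1 m2 l k" "cross_ratio_extends i j m1 m3 l k" "cross_ratio_extends i j m2 m3 l k"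
    "cross_ratio_extends i j m1 m2 m3 l" "cross_ratio_extends i j m1 m2 m3 k"
    using rest_distinct[OF m] kl by (auto intro!: cross_ratio_extends_all[OF ij])
  obtain g1 where g1: "continuous_map blowup proj_space g1"
      "\<And>L. L \<in> main_stratum \<Longrightarrow> g1 (Inl (chart_coords i j L)) = cross_ratio m1 m2 l k L"
    using e(1) by (auto simp: cross_ratio_extends_def)
  obtain g2 where g2: "continuous_map blowup proj_space g2"
      "\<And>L. L \<in> main_stratum \<Longrightarrow> g2 (Inl (chart_coords i j L)) = cross_ratio m1 m3 l k L"
    using e(2) by (auto simp: cross_ratio_extends_def)
  obtain g3 where g3: "continuous_map blowup proj_space g3"
      "\<And>L. L \<in> main_stratum \<Longrightarrow> g3 (Inl (chart_coords i j L)) = cross_ratio m2 m3 l k L"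
    using e(3) by (auto simp: cross_ratio_extends_def)
  obtain g4 where g4: "continuous_map blowup proj_space g4"
      "\<And>L. L \<in> main_stratum \<Longrightarrow> g4 (Inl (chart_coords i j L)) = cross_ratio m1 m2 m3 l L"
    using e(4) by (auto simp: cross_ratio_extends_def)
  obtain g5 where g5: "continuous_map blowup proj_space g5"
      "\<And>L. L \<in> main_stratum \<Longrightarrow> g5 (Inl (chart_coords i j L)) = cross_ratio m1 m2 m3 k L"
    using e(5) by (auto simp: cross_ratio_extends_def)
  show thesis
  proof (rule that[of "\<lambda>x. (g1 x, g2 x, g3 x, g4 x, g5 x)"])
    show "continuous_map blowup cp1_fifth (\<lambda>x. (g1 x, g2 x, g3 x, g4 x, g5 x))"
      by (intro continuous_map_pairedI g1 g2 g3 g4 g5)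
    fix L assume L: "L \<in> main_stratum"
    have "\<Psi> (Inl (chart_coords k l L)) = cross_ratios (chart_lift (frame L) k l m1 m2 m3)"
      unfolding chart_coords_lift[OF L kl m] by (rule \<Psi>[OF lift_in_cover[OF main_stratum_frame(1)[OF L] kl m]])
    then show "(g1 (Inl (chart_coords i j L)), g2 (Inl (chart_coords i j L)), g3 (Inl (chart_coords i j L)),
        g4 (Inl (chart_coords i j L)), g5 (Inl (chart_coords i j L))) = \<Psi> (Inl (chart_coords k l L))"
      unfolding cross_ratios_lift[OF L kl m] by (simp add: g1 g2 g3 g4 g5 L)
  qed
qed

text \<open>Parametrized by planes, so that the images in two charts are indexed by the same set, as
  \<open>compact_extension_homeomorphic\<close> requires.\<close>

definition chart_image :: "5 \<Rightarrow> 5 \<Rightarrow> blowup_point set" where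
  "chart_image i j = (\<lambda>L. Inl (chart_coords i j L)) ` main_stratum"

lemma change_of_charts:
  assumes "i \<noteq> j" "k \<noteq> l"
  obtains \<Phi> \<Phi>' where
    "homeomorphic_maps (subtopology blowup (blowup closure_of chart_image i j))
       (subtopology blowup (blowup closure_of chart_image k l)) \<Phi> \<Phi>'"
    "\<And>L. L \<in> main_stratum \<Longrightarrow> \<Phi> (Inl (chart_coords i j L)) = Inl (chart_coords k l L)"
    "\<And>L. L \<in> main_stratum \<Longrightarrow> \<Phi>' (Inl (chart_coords k l L)) = Inl (chart_coords i j L)"
proof -
  obtain \<Psi> where \<Psi>: "continuous_map blowup cp1_fifth \<Psi>" "inj_on \<Psi> (topspace blowup)"
    "\<And>x. x \<in> surface_cover \<Longrightarrow> \<Psi> (Inl (lines x)) = cross_ratios x"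
    by (rule blowup_embedding) (assumption | rule that)+
  obtain G where G: "continuous_map blowup cp1_fifth G"
    "\<And>L. L \<in> main_stratum \<Longrightarrow> G (Inl (chart_coords i j L)) = \<Psi> (Inl (chart_coords k l L))"
    by (rule transition_map_extends[OF assms \<Psi>(3)]) (assumption | rule that)+
  obtain G' where G': "continuous_map blowup cp1_fifth G'"
    "\<And>L. L \<in> main_stratum \<Longrightarrow> G' (Inl (chart_coords k l L)) = \<Psi> (Inl (chart_coords i j L))"
    by (rule transition_map_extends[OF assms(2,1) \<Psi>(3)]) (assumption | rule that)+
  have top: "Inl (chart_coords i j L) \<in> topspace blowup" if "L \<in> main_stratum" "i \<noteq> j" for L i j
    using chart_coords_cover[OF that] Inl_lines_in_blowup by metis
  have "Hausdorff_space cp1_fifth"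
    by (simp add: Hausdorff_space_prod_topology Hausdorff_proj_space)
  then show thesis
    by (rule compact_extension_homeomorphic[OF compact_space_blowup _ \<Psi>(1,2) G(1) G'(1)
          top[OF _ assms(1)] top[OF _ assms(2)] G(2) G'(2)])
      (assumption | rule that[unfolded chart_image_def])+
qed

section \<open>Transport of the spaces \<open>F_tilde\<close> along the change of charts\<close>

lemma F_chart_representative:
  assumes "c \<in> F_chart i j" "i \<noteq> j"
  shows "\<exists>L\<in>main_stratum. c = chart_coords i j L \<and> f_chart i j c = orbit ctorus L \<and>
    (\<forall>k l. F_coords k l (orbit ctorus L) = chart_coords k l L)"
proof -
  obtain y where y: "y \<in> F_main" "c = F_coords i j y" using F_chart_subset assms by blast
  then have fy: "f_chart i j c = y"
    unfolding f_chart_def using F_coords_inj[OF assms(2)] by (simp add: inv_into_f_f)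
  obtain L where "L \<in> main_stratum" "y = orbit ctorus L" "\<And>i j. F_coords i j y = chart_coords i j L"
    using F_main_representative[OF y(1)] by blast
  then show ?thesis using y fy by (intro bexI[of _ L]) simp_all
qed

lemma F_chart_subset_closure:
  assumes "c \<in> F_chart i j" "i \<noteq> j"
  shows "Inl c \<in> blowup closure_of chart_image i j"
proof -
  obtain L where L: "L \<in> main_stratum" "c = chart_coords i j L"
    using F_chart_representative[OF assms] by blast
  obtain x where "x \<in> surface_cover" "chart_coords i j L = lines x"
    using chart_coords_cover[OF L(1) assms(2)] .
  then have "Inl c \<in> topspace blowup" using L Inl_lines_in_blowup by simp
  moreover have "Inl c \<in> chart_image i j" using L by (simp add: chart_image_def)
  ultimately show ?thesis using subsetD[OF closure_of_subset_Int, of "Inl c" blowup "chart_image i j"] by simp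
qed

lemma F_tilde_subset_closure:
  assumes "i \<noteq> j"
  shows "F_tilde \<sigma> i j \<subseteq> blowup closure_of chart_image i j"
proof
  fix c assume "c \<in> F_tilde \<sigma> i j"
  then obtain c_seq where lim: "limitin blowup (\<lambda>n. Inl (c_seq n)) c sequentially"
      and "\<And>n::nat. c_seq n \<in> F_chart i j" unfolding F_tilde_def by blast
  then have "Inl (c_seq n) \<in> blowup closure_of chart_image i j" for n
    by (intro F_chart_subset_closure assms)
  then show "c \<in> blowup closure_of chart_image i j"
    by (intro limitin_closedin[OF lim closedin_closure_of]) simp_all
qed

lemma F_tilde_image:
  assumes ij: "i \<noteq> j" and kl: "k \<noteq> l"
    and \<Phi>: "continuous_map (subtopology blowup (blowup closure_of chart_image i j))
       (subtopology blowup (blowup closure_of chart_image k l)) \<Phi>"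
      "\<And>L. L \<in> main_stratum \<Longrightarrow> \<Phi> (Inl (chart_coords i j L)) = Inl (chart_coords k l L)"
    and c: "c \<in> F_tilde \<sigma> i j"
  shows "\<Phi> c \<in> F_tilde \<sigma> k l"
proof -
  obtain x c_seq q where x: "\<And>n::nat. x n \<in> rel_interior hypersimplex" and c_seq: "\<And>n. c_seq n \<in> F_chart i j"
    and lim: "limitin blowup (\<lambda>n. Inl (c_seq n)) c sequentially" and q: "q \<in> orbit torus ` stratum \<sigma>"
    and lim_q: "limitin orbit_space (\<lambda>n. h_inv (x n, f_chart i j (c_seq n))) q sequentially"
    using c unfolding F_tilde_def by blast
  have "\<exists>L. L \<in> main_stratum \<and> c_seq n = chart_coords i j L \<and> f_chart i j (c_seq n) = orbit ctorus L \<and>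
      F_coords k l (orbit ctorus L) = chart_coords k l L" for n
    using F_chart_representative[OF c_seq ij] by blast
  then obtain L where L: "\<And>n. L n \<in> main_stratum" "\<And>n. c_seq n = chart_coords i j (L n)"
    "\<And>n. f_chart i j (c_seq n) = orbit ctorus (L n)"
    "\<And>n. F_coords k l (orbit ctorus (L n)) = chart_coords k l (L n)" by metis
  \<comment> \<open>The same planes read in the other chart; the sequence of orbits given by
    \<open>h_inv\<close> is therefore literally unchanged.\<close>
  define d where "d n = chart_coords k l (L n)" for n
  have "d n \<in> F_chart k l" for n
    unfolding d_def by (rule chart_coords_in_F_chart[OF L(1) kl])
  moreover have "f_chart k l (d n) = f_chart i j (c_seq n)" for n
  proof -
    have "orbit ctorus (L n) \<in> F_main" using L(1) by (simp add: F_main_def)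
    then show ?thesis
      unfolding f_chart_def[of k l] d_def L(4)[symmetric] L(3)
      by (rule inv_into_f_f[OF F_coords_inj[OF kl]])
  qed
  moreover have "limitin blowup (\<lambda>n. Inl (d n)) (\<Phi> c) sequentially"
  proof -
    \<comment> \<open>\<Phi> is continuous only on the closure of the chart image, so the
      convergence has to be transferred to this subspace before \<Phi> is applied.\<close>
    have "Inl (c_seq n) \<in> blowup closure_of chart_image i j" for n
      using F_chart_subset_closure[OF c_seq ij] .
    then have "limitin (subtopology blowup (blowup closure_of chart_image i j)) (\<lambda>n. Inl (c_seq n)) c sequentially"
      using lim subsetD[OF F_tilde_subset_closure[OF ij] c] by (simp add: limitin_subtopology)
    then have "limitin (subtopology blowup (blowup closure_of chart_image k l)) (\<Phi> \<circ> (\<lambda>n. Inl (c_seq n))) (\<Phi> c) sequentially"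
      by (rule continuous_map_limit[OF \<Phi>(1)])
    moreover have "\<Phi> \<circ> (\<lambda>n. Inl (c_seq n)) = (\<lambda>n. Inl (d n))"
      using \<Phi>(2) L(1,2) by (auto simp: d_def)
    ultimately show ?thesis by (simp add: limitin_subtopology)
  qed
  ultimately show ?thesis
    using x q lim_q limitin_topspace unfolding F_tilde_def by (intro CollectI conjI exI[of _ x] exI[of _ d]) auto
qed

theorem theorem7p3:
  fixes \<sigma> :: "5 set set" and i j k l :: 5
  assumes "admissible \<sigma>"
    and "i < j" and "k < l"
  shows "subtopology blowup (F_tilde \<sigma> i j) homeomorphic_space subtopology blowup (F_tilde \<sigma> k l)"
proof -
  have ij: "i \<noteq> j" and kl: "k \<noteq> l" using assms(2,3) by auto
  let ?C = "\<lambda>i j. blowup closure_of chart_image i j"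
  obtain \<Phi> \<Phi>' where \<Phi>: "homeomorphic_maps (subtopology blowup (?C i j)) (subtopology blowup (?C k l)) \<Phi> \<Phi>'"
    "\<And>L. L \<in> main_stratum \<Longrightarrow> \<Phi> (Inl (chart_coords i j L)) = Inl (chart_coords k l L)"
    "\<And>L. L \<in> main_stratum \<Longrightarrow> \<Phi>' (Inl (chart_coords k l L)) = Inl (chart_coords i j L)"
    by (rule change_of_charts[OF ij kl]) (assumption | rule that)+
  have cont: "continuous_map (subtopology blowup (?C i j)) (subtopology blowup (?C k l)) \<Phi>"
    "continuous_map (subtopology blowup (?C k l)) (subtopology blowup (?C i j)) \<Phi>'"
    using \<Phi>(1) by (auto simp: homeomorphic_maps_def)
  \<comment> \<open>Each of the two mutually inverse maps carries one \<open>F_tilde\<close> into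
    the other, so they restrict to inverse homeomorphisms.\<close>
  have "homeomorphic_maps (subtopology (subtopology blowup (?C i j)) (F_tilde \<sigma> i j))
      (subtopology (subtopology blowup (?C k l)) (F_tilde \<sigma> k l)) \<Phi> \<Phi>'"
    using F_tilde_image[OF ij kl cont(1) \<Phi>(2)] F_tilde_image[OF kl ij cont(2) \<Phi>(3)]
    by (intro homeomorphic_maps_subtopologies_alt[OF \<Phi>(1)]) auto
  then show ?thesis
    using F_tilde_subset_closure[OF ij] F_tilde_subset_closure[OF kl]
    by (simp add: subtopology_subtopology inf_absorb2 homeomorphic_maps_imp_homeomorphic_space)
qed

end
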